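(* Let $a$ be a nonzero integer, let $K$ be a quadratic field, and let $E$ be the elliptic curve $y^2 = x^3 + a$, with $E(K)$ its group of $K$-rational points and $E(K)_{tors}$ the torsion subgroup of $E(K)$. (i) Suppose $a$ is the sixth power of an integer. If $K \neq \mathbb{Q}(\sqrt{-3})$, then $E(K)_{tors}$ is isomorphic to one of $\mathbb{Z}/6\mathbb{Z}$, $\mathbb{Z}/12\mathbb{Z}$, or $\mathbb{Z}/18\mathbb{Z}$. If $K = \mathbb{Q}(\sqrt{-3})$, then $E(K)_{tors}$ is isomorphic to $\mathbb{Z}/2\mathbb{Z} \oplus \mathbb{Z}/6\mathbb{Z}$. (ii) Suppose $a$ is the square of an integer but not the sixth power of an integer. If $K \neq \mathbb{Q}(\sqrt{-3})$, then $E(K)_{tors}$ is isomorphic to $\mathbb{Z}/3\mathbb{Z}$ or $\mathbb{Z}/9\mathbb{Z}$. If $K = \mathbb{Q}(\sqrt{-3})$, then $E(K)_{tors}$ is isomorphic to one of $\mathbb{Z}/3\mathbb{Z}$, $\mathbb{Z}/9\mathbb{Z}$, or $\mathbb{Z}/3\mathbb{Z} \oplus \mathbb{Z}/3\mathbb{Z}$.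
   Context: A quadratic field is a field extension of $\mathbb{Q}$ of degree $2$. $E(K)$ consists of the affine points $(x,y) \in K^2$ satisfying the equation together with the point at infinity $\mathcal{O}$, which is the identity of the group law. *)

theory Defs
  imports Complex_Main "HOL-Algebra.Elementary_Groups"
begin

section \<open>Quadratic fields\<close>

text \<open>
  A field containing \<open>\<rat>\<close> is a type of class \<^class>\<open>field_char_0\<close>, regarded as a vector space over
  \<open>\<rat>\<close> via \<^const>\<open>of_rat\<close>. Since \<open>dim\<close> is \<open>0\<close> on infinite-dimensional spaces, the value \<open>2\<close>
  below does mean degree two.
\<close>

lemma vector_space_of_rat:
  "vector_space (\<lambda>(q :: rat) (x :: 'k :: field_char_0). of_rat q * x)"
  by unfold_locales (simp_all add: algebra_simps of_rat_add of_rat_mult)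

definition quadratic_field :: "'k :: field_char_0 itself \<Rightarrow> bool" where
  "quadratic_field _ \<longleftrightarrow>
     vector_space.dim (\<lambda>(q :: rat) (x :: 'k). of_rat q * x) UNIV = 2"

definition is_subfield :: "'a :: field set \<Rightarrow> bool" where
  "is_subfield S \<longleftrightarrow> 0 \<in> S \<and> 1 \<in> S \<and>
     (\<forall>x\<in>S. \<forall>y\<in>S. x + y \<in> S \<and> x * y \<in> S) \<and>
     (\<forall>x\<in>S. - x \<in> S \<and> inverse x \<in> S)"

definition Q_sqrt_minus_3 :: "complex set" where
  "Q_sqrt_minus_3 = is_subfield hull {csqrt (- 3)}"

text \<open>
  An abstract field is \<open>\<rat>(\<surd>-3)\<close> if it is isomorphic to the subfield
  \<open>\<rat>(\<surd>-3)\<close> of the complex numbers.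
\<close>

definition is_Q_sqrt_minus_3 :: "'k :: field_char_0 itself \<Rightarrow> bool" where
  "is_Q_sqrt_minus_3 _ \<longleftrightarrow>
     (\<exists>\<phi> :: 'k \<Rightarrow> complex.
        bij_betw \<phi> UNIV Q_sqrt_minus_3 \<and> \<phi> 1 = 1 \<and>
        (\<forall>x y. \<phi> (x + y) = \<phi> x + \<phi> y) \<and>
        (\<forall>x y. \<phi> (x * y) = \<phi> x * \<phi> y))"


section \<open>Elliptic curves in short Weierstrass form\<close>

datatype 'k point = Infinity | Affine 'k 'k

text \<open>The \<open>'k\<close>-rational points of \<open>y\<^sup>2 = x\<^sup>3 + A x + B\<close>.\<close>

definition ec_points :: "'k :: field \<Rightarrow> 'k \<Rightarrow> 'k point set" where
  "ec_points A B = {Infinity} \<union> {Affine x y | x y. y ^ 2 = x ^ 3 + A * x + B}"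

text \<open>
  The chord-and-tangent law. Two points of the curve with the same abscissa have equal or
  opposite ordinates, so \<open>x1 = x2\<close> and \<open>y1 \<noteq> - y2\<close> is the case of doubling a point that is not of
  order two.
\<close>

fun ec_add :: "'k :: field \<Rightarrow> 'k point \<Rightarrow> 'k point \<Rightarrow> 'k point" where
  "ec_add A Infinity Q = Q"
| "ec_add A (Affine x1 y1) Infinity = Affine x1 y1"
| "ec_add A (Affine x1 y1) (Affine x2 y2) =
     (if x1 = x2 \<and> y1 = - y2 then Infinity
      else
        let l = (if x1 = x2 then (3 * x1 ^ 2 + A) / (2 * y1) else (y2 - y1) / (x2 - x1));
            x3 = l ^ 2 - x1 - x2
        in Affine x3 (l * (x1 - x3) - y1))"

definition ec_group :: "'k :: field \<Rightarrow> 'k \<Rightarrow> 'k point monoid" where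
  "ec_group A B = \<lparr>carrier = ec_points A B, monoid.mult = ec_add A, one = Infinity\<rparr>"

definition torsion_subgroup :: "('g, 'm) monoid_scheme \<Rightarrow> ('g, 'm) monoid_scheme" where
  "torsion_subgroup G =
     G\<lparr>carrier := {P \<in> carrier G. \<exists>n :: nat. n > 0 \<and> P [^]\<^bsub>G\<^esub> n = \<one>\<^bsub>G\<^esub>}\<rparr>"

end

theory Submission
  imports Defs "HOL-Computational_Algebra.Primes"
begin

text \<open>
  Let \<open>P\<close> be a torsion point over the quadratic field \<open>K\<close> with conjugation \<open>\<sigma>\<close>. The points
  \<open>P + \<sigma> P\<close> and \<open>P - \<sigma> P\<close> are torsion and have rational abscissas. For a torsion point with
  rational abscissa \<open>x\<close>, the number \<open>t = x\<^sup>3 / a\<close> has a finite orbit under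
  \<open>t \<mapsto> t (t - 8)\<^sup>3 / (64 (t + 1)\<^sup>3)\<close>, the action of doubling. Unless \<open>t\<close> is one of \<open>0, -1, 8, -4\<close>,
  the 2-adic valuation of \<open>t\<close> or of \<open>t + 4\<close> is eventually strictly monotone along the orbit, which
  is absurd; so these points are killed by 6, and \<open>12 P = 0\<close>. If \<open>a = b\<^sup>6\<close>, a point of order 4 would
  make \<open>-9 + 6 \<surd>3\<close> a square in \<open>\<rat>(\<surd>3)\<close>, which is impossible as \<open>p\<^sup>2 + 3 q\<^sup>2 > -9\<close>; if \<open>a\<close> is a
  square but not a sixth power there is not even a point of order 2. Hence the torsion subgroup is
  the 6-torsion or the 3-torsion, which is read off from the equation. In particular
  \<open>\<int>/9\<close>, \<open>\<int>/12\<close> and \<open>\<int>/18\<close> never occur.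
\<close>

text \<open>The quotient \<open>t = x ^ 3 / a\<close> does not change under the automorphisms of the
  curve over an algebraic closure, which multiply \<open>x\<close> by cube roots of unity and
  \<open>y\<close> by signs, nor under the scaling that relates different \<open>a\<close>. So the
  single rational map \<open>dbl_cube\<close> serves all \<open>a\<close>, and only rational numbers
  need a valuation: \<open>t\<close> is rational as soon as \<open>x\<close> is, whatever
  \<open>y\<close> may be. The rational fixed points of this map are infinity, \<open>0\<close> and
  \<open>-4\<close>, with multipliers \<open>64\<close>, \<open>-8\<close> and \<open>-2\<close>.
  All three attract 2-adically, at the speeds 6, 3 and 1 that the valuation lemmas exhibit, and
  every rational \<open>t\<close> falls towards one of them. The exceptional values are the torsion
  itself: \<open>0\<close> and \<open>-4\<close> belong to the points of order 3, \<open>-1\<close>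
  to those with \<open>y = 0\<close>, and \<open>8\<close> is sent to \<open>0\<close>, which gives
  order 6. Passing from \<open>P\<close> to \<open>2 P\<close>, the sum of the two auxiliary points,
  loses a factor 2. Winning it back, by excluding points of order 4 or of order 2, is where the
  shape of \<open>a\<close> enters.\<close>

section \<open>The group law\<close>

text \<open>
  For points of the curve, the two equations characterise the slope of the chord and, if the points
  coincide, of the tangent, so that most of what follows need not distinguish these cases.
\<close>

definition chord_slope :: "'k :: field \<Rightarrow> 'k \<Rightarrow> 'k \<Rightarrow> 'k \<Rightarrow> 'k \<Rightarrow> 'k \<Rightarrow> bool" where
  "chord_slope A x1 y1 x2 y2 l \<longleftrightarrow> \<not> (x1 = x2 \<and> y1 = - y2) \<and>
     l * (x1 - x2) = y1 - y2 \<and> l * (y1 + y2) = x1 ^ 2 + x1 * x2 + x2 ^ 2 + A"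

lemma chord_slope_commute: "chord_slope A x1 y1 x2 y2 l \<longleftrightarrow> chord_slope A x2 y2 x1 y1 l"
proof -
  have "chord_slope A x2 y2 x1 y1 l" if "chord_slope A x1 y1 x2 y2 l" for x1 y1 x2 y2
    using that unfolding chord_slope_def
    by (smt (verit, ccfv_threshold) add.commute add.assoc minus_diff_eq minus_minus mult.commute mult_minus_right)
  then show ?thesis by blast
qed

lemma chord_slope_exists:
  fixes x1 :: "'k :: field_char_0"
  assumes "y1 ^ 2 = x1 ^ 3 + A * x1 + B" "y2 ^ 2 = x2 ^ 3 + A * x2 + B"
    and "\<not> (x1 = x2 \<and> y1 = - y2)"
  obtains l where "chord_slope A x1 y1 x2 y2 l"
proof (cases "x1 = x2")
  case True
  then have "y1 ^ 2 = y2 ^ 2"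
    using assms(1,2) by simp
  then have "y1 = y2 \<or> y1 = - y2" by (simp add: power2_eq_iff)
  then have y: "y1 = y2" "y1 \<noteq> 0"
    using assms(3) True by auto
  have "chord_slope A x1 y1 x2 y2 ((3 * x1 ^ 2 + A) / (2 * y1))"
    using y True assms(3) unfolding chord_slope_def by (simp add: field_simps power2_eq_square)
  then show ?thesis by (rule that)
next
  case False
  have "(y1 - y2) * (y1 + y2) = (x1 ^ 2 + x1 * x2 + x2 ^ 2 + A) * (x1 - x2)"
    using assms(1,2) by algebra
  then have "chord_slope A x1 y1 x2 y2 ((y1 - y2) / (x1 - x2))"
    using False unfolding chord_slope_def by (simp add: divide_simps)
  then show ?thesis by (rule that)
qed

lemma ec_add_chord:
  fixes x1 :: "'k :: field_char_0"
  assumes "chord_slope A x1 y1 x2 y2 l" "x3 = l ^ 2 - x1 - x2"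
  shows "ec_add A (Affine x1 y1) (Affine x2 y2) = Affine x3 (l * (x1 - x3) - y1)"
proof -
  have *: "\<not> (x1 = x2 \<and> y1 = - y2)" "l * (x1 - x2) = y1 - y2"
    "l * (y1 + y2) = x1 ^ 2 + x1 * x2 + x2 ^ 2 + A"
    using assms(1) unfolding chord_slope_def by auto
  have "l = (if x1 = x2 then (3 * x1 ^ 2 + A) / (2 * y1) else (y2 - y1) / (x2 - x1))"
  proof (cases "x1 = x2")
    case True
    with * have "y1 = y2" by simp
    with True * show ?thesis by (auto simp: field_simps power2_eq_square)
  next
    case False
    with *(2) show ?thesis by (simp add: field_simps) 
  qed
  with *(1) assms(2) show ?thesis by (simp add: Let_def)
qed

text \<open>A monic cubic in \<open>x\<close> whose coefficient of \<open>x ^ 2\<close> is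
  \<open>- (l ^ 2)\<close>, so \<open>x3\<close> is its third root by Vieta. The second equation of
  \<open>chord_slope\<close> covers the tangent, where \<open>x1 = x2\<close> is a double
  root.\<close>

lemma line_cuts_cubic:
  fixes x1 :: "'k :: field"
  assumes "y1 ^ 2 = x1 ^ 3 + A * x1 + B" "chord_slope A x1 y1 x2 y2 l" "x3 = l ^ 2 - x1 - x2"
  shows "x ^ 3 + A * x + B - (y1 + l * (x - x1)) ^ 2 = (x - x1) * (x - x2) * (x - x3)"
  using assms unfolding chord_slope_def by algebra

lemma third_point_on_curve:
  fixes x1 :: "'k :: field"
  assumes "y1 ^ 2 = x1 ^ 3 + A * x1 + B" "chord_slope A x1 y1 x2 y2 l" "x3 = l ^ 2 - x1 - x2"
  shows "(l * (x1 - x3) - y1) ^ 2 = x3 ^ 3 + A * x3 + B"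
  using line_cuts_cubic[OF assms, of x3] by algebra

text \<open>
  The heart of associativity: applied to \<open>P, Q, R\<close> and to \<open>R, Q, P\<close>, where \<open>l\<^sub>4\<close> is the slope for
  \<open>P\<close> and \<open>Q + R\<close>, it gives \<open>(l\<^sub>1 + l\<^sub>3 - l\<^sub>2 - l\<^sub>4) (l\<^sub>1 - l\<^sub>2) = 0\<close>, and \<open>l\<^sub>1 = l\<^sub>2\<close> only if \<open>P = R\<close>.
\<close>

lemma four_slopes:
  fixes xP :: "'k :: field_char_0"
  assumes P: "yP ^ 2 = xP ^ 3 + A * xP + B" and Q: "yQ ^ 2 = xQ ^ 3 + A * xQ + B"
    and R: "yR ^ 2 = xR ^ 3 + A * xR + B"
    and l1: "chord_slope A xP yP xQ yQ l1" and l2: "chord_slope A xQ yQ xR yR l2"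
    and xS: "xS = l1 ^ 2 - xP - xQ" and yS: "yS = l1 * (xP - xS) - yP"
    and l3: "chord_slope A xS yS xR yR l3"
  shows "(l1 + l3) * (l1 - l2) = xP - xR"
proof -
  note cubic = line_cuts_cubic[OF P l1 xS]
  have l1': "l1 * (xP - xQ) = yP - yQ"
    and l2': "l2 * (xQ - xR) = yQ - yR" "l2 * (yQ + yR) = xQ ^ 2 + xQ * xR + xR ^ 2 + A"
    and l3': "l3 * (xS - xR) = yS - yR" "l3 * (yS + yR) = xS ^ 2 + xS * xR + xR ^ 2 + A"
    using l1 l2 l3 unfolding chord_slope_def by auto
  \<comment> \<open>The coefficient of \<open>x\<close> in \<open>line_cuts_cubic\<close>. It gives
    the derivative of that cubic at a root, needed when \<open>R\<close> has the abscissa of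
    \<open>Q\<close> or of \<open>S\<close>.\<close>
  have l1'': "2 * l1 * yP = A - xP * xQ - xP * xS - xQ * xS + 2 * l1 ^ 2 * xP"
  proof -
    have "l1 * (yP + yQ) = xP ^ 2 + xP * xQ + xQ ^ 2 + A"
      using l1 unfolding chord_slope_def by auto
    with l1' xS show ?thesis by algebra
  qed
  consider "xR \<noteq> xS" "xR \<noteq> xQ" | "xR = xQ" | "xR = xS" "xR \<noteq> xQ" by blast
  then show ?thesis
  proof cases
    case 1
    \<comment> \<open>If the line through \<open>P\<close> and \<open>Q\<close> has height
      \<open>L\<close> at \<open>xR\<close>, the two products are \<open>L + yR\<close> and
      \<open>L - yR\<close>; multiplied, they give minus the cubic of \<open>line_cuts_cubic\<close>
      at \<open>xR\<close>.\<close>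
    have "(l1 + l3) * (xR - xS) = yP + l1 * (xR - xP) + yR"
      using l3' yS by algebra
    moreover have "(l1 - l2) * (xR - xQ) = yP + l1 * (xR - xP) - yR"
      using l1' l2' by algebra
    ultimately have "((l1 + l3) * (xR - xS)) * ((l1 - l2) * (xR - xQ)) = - ((xR - xP) * (xR - xQ) * (xR - xS))"
      using cubic[of xR] R by algebra
    then have "((l1 + l3) * (l1 - l2) - (xP - xR)) * ((xR - xS) * (xR - xQ)) = 0"
      by algebra
    with 1 show ?thesis by simp
  next
    case 2
    then have y: "yR = yQ" "yQ \<noteq> 0"
      using l2 unfolding chord_slope_def by auto
    \<comment> \<open>Both sides are the derivative of the cubic at its root \<open>xQ\<close>,
      since \<open>2 * yQ * l2 = 3 * xQ ^ 2 + A\<close>. The last case does the same at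
      \<open>xS\<close>.\<close>
    have "2 * yQ * (l2 - l1) = (xQ - xP) * (xQ - xS)"
      using l1'' l1' l2' 2 y xS by algebra
    moreover have *: "2 * yQ = (l1 + l3) * (xQ - xS)"
      using l3' 2 y yS l1' by algebra
    ultimately have "((l1 + l3) * (l1 - l2) - (xP - xR)) * (xQ - xS) = 0"
      using 2 by algebra
    moreover have "xQ \<noteq> xS" using * y by auto
    ultimately show ?thesis by simp
  next
    case 3
    then have y: "yR = yS"
      using l3 unfolding chord_slope_def by auto
    have "2 * yR * (l1 + l3) = (xR - xP) * (xR - xQ)"
      using l1'' l1' l3' 3 y yS xS by algebra
    moreover have "- 2 * yR = (l1 - l2) * (xR - xQ)"
      using l2' 3 y yS l1' by algebra
    ultimately have "((l1 + l3) * (l1 - l2) - (xP - xR)) * (xR - xQ) = 0"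
      by algebra
    with 3 show ?thesis by simp
  qed
qed

section \<open>Opposite points and the group axioms\<close>

fun ec_neg :: "'k :: field point \<Rightarrow> 'k point" where
  "ec_neg Infinity = Infinity"
| "ec_neg (Affine x y) = Affine x (- y)"

lemma ec_neg_neg [simp]: "ec_neg (ec_neg P) = P"
  by (cases P) auto

lemma ec_add_Infinity [simp]: "ec_add A P Infinity = P"
  by (cases P) auto

lemma Affine_in_ec_points [simp]:
  "Affine x y \<in> ec_points A B \<longleftrightarrow> y ^ 2 = x ^ 3 + A * x + B"
  by (auto simp: ec_points_def)

lemma Infinity_in_ec_points [simp]: "Infinity \<in> ec_points A B"
  by (simp add: ec_points_def)

lemma ec_neg_closed [simp]: "ec_neg P \<in> ec_points A B \<longleftrightarrow> P \<in> ec_points A B"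
  by (cases P) auto

lemma ec_add_neg [simp]: "ec_add A P (ec_neg P) = Infinity" "ec_add A (ec_neg P) P = Infinity"
  by (cases P; simp)+

lemma ec_addE:
  fixes P :: "'k :: field_char_0 point"
  assumes "P \<in> ec_points A B" "Q \<in> ec_points A B"
  obtains "P = Infinity" | "Q = Infinity" | "Q = ec_neg P"
  | x1 y1 x2 y2 l x3 y3 where "P = Affine x1 y1" "Q = Affine x2 y2" "Q \<noteq> ec_neg P"
      "y1 ^ 2 = x1 ^ 3 + A * x1 + B" "y2 ^ 2 = x2 ^ 3 + A * x2 + B"
      "chord_slope A x1 y1 x2 y2 l" "x3 = l ^ 2 - x1 - x2" "y3 = l * (x1 - x3) - y1"
      "ec_add A P Q = Affine x3 y3"
proof (cases P)
  case P: (Affine x1 y1)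
  show ?thesis
  proof (cases Q)
    case Q: (Affine x2 y2)
    show ?thesis
    proof (cases "x1 = x2 \<and> y1 = - y2")
      case False
      obtain l where l: "chord_slope A x1 y1 x2 y2 l"
        using chord_slope_exists assms P Q False by (metis Affine_in_ec_points)
      show ?thesis
        by (rule that(4)[OF P Q _ _ _ l refl refl])
          (use P Q False assms ec_add_chord[OF l refl] in \<open>simp_all del: ec_add.simps, auto\<close>)
    qed (use that P Q in auto)
  qed (use that in auto)
qed (use that in auto)

lemma ec_add_closed:
  fixes P :: "'k :: field_char_0 point"
  assumes "P \<in> ec_points A B" "Q \<in> ec_points A B"
  shows "ec_add A P Q \<in> ec_points A B"
  using assms
proof (cases rule: ec_addE)
  case (4 x1 y1 x2 y2 l x3 y3)
  show ?thesis
    unfolding 4(8,9) Affine_in_ec_points by (rule third_point_on_curve) (fact 4)+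
qed (use assms in auto)

lemma ec_add_commute:
  fixes P :: "'k :: field_char_0 point"
  assumes "P \<in> ec_points A B" "Q \<in> ec_points A B"
  shows "ec_add A P Q = ec_add A Q P"
  using assms
proof (cases rule: ec_addE)
  case (4 x1 y1 x2 y2 l x3 y3)
  have l: "l * (x1 - x2) = y1 - y2"
    using 4(6) unfolding chord_slope_def by simp
  have "ec_add A Q P = Affine x3 (l * (x2 - x3) - y2)"
    unfolding 4(1,2) using 4(6,7) by (intro ec_add_chord) (auto simp: chord_slope_commute)
  moreover have "l * (x2 - x3) - y2 = y3"
    using l 4(8) by algebra
  ultimately show ?thesis using 4(9) by simp
qed auto

locale elliptic_curve =
  fixes A B :: "'k :: field_char_0"
  assumes nonsingular: "x ^ 3 + A * x + B = 0 \<Longrightarrow> 3 * x ^ 2 + A \<noteq> 0"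
begin

text \<open>The line through \<open>-P\<close> and \<open>P + R\<close> is the mirror image of the
  line through \<open>P\<close> and \<open>R\<close>, with slope \<open>- l\<close>. The danger is
  \<open>P + R = P\<close>: then the line would meet the curve doubly at \<open>P = -P\<close>, a
  singular point. Nonsingularity is invoked here.\<close>

lemma ec_neg_add_cancel:
  assumes "P \<in> ec_points A B" "R \<in> ec_points A B"
  shows "ec_add A (ec_neg P) (ec_add A P R) = R"
  using assms
proof (cases rule: ec_addE)
  case (4 x1 y1 x2 y2 l x3 y3)
  have l: "l * (x1 - x2) = y1 - y2" "l * (y1 + y2) = x1 ^ 2 + x1 * x2 + x2 ^ 2 + A"
    using 4(6) unfolding chord_slope_def by auto
  have opp: "\<not> (x1 = x3 \<and> - y1 = - y3)"
  proof
    assume *: "x1 = x3 \<and> - y1 = - y3"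
    with 4(8) have "2 * y1 = 0" by simp
    then have y: "y1 = 0" by simp
    have "3 * x1 ^ 2 + A = 0" using * l y 4(7) by algebra
    moreover have "x1 ^ 3 + A * x1 + B = 0" using 4(4) y by simp
    ultimately show False using nonsingular by blast
  qed
  have "chord_slope A x1 (- y1) x3 y3 (- l)"
    unfolding chord_slope_def
  proof (intro conjI)
    show "- l * (x1 - x3) = - y1 - y3" using 4(8) by simp
    show "- l * (- y1 + y3) = x1\<^sup>2 + x1 * x3 + x3\<^sup>2 + A" using l 4(7,8) by algebra
  qed (rule opp)
  moreover have "x2 = (- l) ^ 2 - x1 - x3" using 4(7) by simp
  ultimately have "ec_add A (Affine x1 (- y1)) (Affine x3 y3) = Affine x2 (- l * (x1 - x2) - - y1)"
    by (rule ec_add_chord)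
  moreover have "- l * (x1 - x2) - - y1 = y2" using l by algebra
  ultimately show ?thesis using 4 by simp
qed auto

text \<open>The relation \<open>P + Q + R = 0\<close> is invariant under cyclic rotation. Being
  derived without associativity, this can settle the degenerate cases of
  \<open>ec_add_assoc\<close>.\<close>

lemma ec_add_eq_neg:
  assumes "P \<in> ec_points A B" "Q \<in> ec_points A B" "ec_add A P Q = ec_neg R"
  shows "ec_add A Q R = ec_neg P"
proof -
  have R: "R \<in> ec_points A B" using assms ec_add_closed ec_neg_closed by metis
  have "ec_add A (ec_neg P) (ec_neg R) = Q"
    using ec_neg_add_cancel[OF assms(1,2)] assms by metis
  then have "ec_add A (ec_neg R) (ec_neg P) = Q"
    using assms(1) R ec_add_commute ec_neg_closed by metis
  then have "ec_add A R Q = ec_neg P"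
    using ec_neg_add_cancel[of "ec_neg R" "ec_neg P"] assms(1) R by simp
  then show ?thesis using ec_add_commute R assms(2) by metis
qed

lemma ec_add_assoc:
  assumes P: "P \<in> ec_points A B" and Q: "Q \<in> ec_points A B" and R: "R \<in> ec_points A B"
  shows "ec_add A (ec_add A P Q) R = ec_add A P (ec_add A Q R)"
proof -
  let ?S = "ec_add A P Q" and ?T = "ec_add A Q R"
  have S: "?S \<in> ec_points A B" and T: "?T \<in> ec_points A B"
    using assms ec_add_closed by auto
  consider "P = Infinity \<or> Q = Infinity \<or> R = Infinity" | "Q = ec_neg P" | "R = ec_neg Q"
    | "R = ec_neg ?S" | "?T = ec_neg P" | "P = R"
    | "P \<noteq> R" "R \<noteq> ec_neg ?S" "?T \<noteq> ec_neg P" "Q \<noteq> ec_neg P" "R \<noteq> ec_neg Q"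
      "P \<noteq> Infinity" "Q \<noteq> Infinity" "R \<noteq> Infinity" by blast
  then show ?thesis
  proof cases
    case 2
    then show ?thesis using ec_neg_add_cancel[of "ec_neg P" R] P R by simp
  next
    case 3
    then show ?thesis
      using ec_neg_add_cancel[of "ec_neg R" P] P R S Q ec_add_commute[of _ A B] by simp
  next
    case 4
    then have "?T = ec_neg P"
      using ec_add_eq_neg[OF P Q, of R] by simp
    with 4 show ?thesis by simp
  next
    case 5
    then have "ec_add A R P = ec_neg Q" using ec_add_eq_neg[OF Q R] by simp
    then have "?S = ec_neg R" using ec_add_eq_neg[OF R P] by simp
    with 5 show ?thesis by simp
  next
    case 6
    then show ?thesis using ec_add_commute P Q R S by metis
  next
    case 7
    from P Q obtain xP yP xQ yQ l1 xS yS where PQ: "P = Affine xP yP" "Q = Affine xQ yQ"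
      "yP ^ 2 = xP ^ 3 + A * xP + B" "yQ ^ 2 = xQ ^ 3 + A * xQ + B"
      "chord_slope A xP yP xQ yQ l1" "xS = l1 ^ 2 - xP - xQ" "yS = l1 * (xP - xS) - yP"
      "?S = Affine xS yS"
      by (cases rule: ec_addE) (use 7 in auto)
    from Q R obtain xR yR l2 xT yT where QR: "R = Affine xR yR"
      "yR ^ 2 = xR ^ 3 + A * xR + B"
      "chord_slope A xQ yQ xR yR l2" "xT = l2 ^ 2 - xQ - xR" "yT = l2 * (xQ - xT) - yQ"
      "?T = Affine xT yT"
      by (cases rule: ec_addE) (use 7 PQ in auto)
    from S R obtain l3 xU yU where SR: "chord_slope A xS yS xR yR l3"
      "xU = l3 ^ 2 - xS - xR" "yU = l3 * (xS - xU) - yS"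
      "ec_add A ?S R = Affine xU yU"
      by (cases rule: ec_addE) (use 7 PQ QR in auto)
    from P T obtain l4 xV yV where PT: "chord_slope A xP yP xT yT l4"
      "xV = l4 ^ 2 - xP - xT" "yV = l4 * (xP - xV) - yP"
      "ec_add A P ?T = Affine xV yV"
      by (cases rule: ec_addE) (use 7 PQ QR in auto)
    have l1: "l1 * (xP - xQ) = yP - yQ" and l2: "l2 * (xQ - xR) = yQ - yR"
      and l3: "l3 * (xS - xR) = yS - yR" and l4: "l4 * (xP - xT) = yP - yT"
      using PQ(5) QR(3) SR(1) PT(1) unfolding chord_slope_def by auto
    have E1: "(l1 + l3) * (l1 - l2) = xP - xR"
      by (rule four_slopes[OF PQ(3,4) QR(2) PQ(5) QR(3) PQ(6,7) SR(1)])
    have E2: "(l2 + l4) * (l2 - l1) = xR - xP"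
    proof (rule four_slopes[OF QR(2) PQ(4) PQ(3)])
      show "chord_slope A xR yR xQ yQ l2" "chord_slope A xQ yQ xP yP l1" "chord_slope A xT yT xP yP l4"
        by (subst chord_slope_commute, fact)+
      show "xT = l2 ^ 2 - xR - xQ" using QR(4) by simp
      show "yT = l2 * (xR - xT) - yR" using QR(5) l2 by algebra
    qed
    have "l1 \<noteq> l2"
    proof
      assume "l1 = l2"
      with E1 have "xP = xR" by simp
      moreover have "yP = yR" using l1 l2 unfolding \<open>l1 = l2\<close> \<open>xP = xR\<close> by algebra
      ultimately show False using 7(1) PQ(1) QR(1) by simp
    qed
    moreover have "(l1 + l3 - l2 - l4) * (l1 - l2) = 0" using E1 E2 by algebra
    ultimately have sum: "l4 = l1 + l3 - l2" by simp
    \<comment> \<open>With \<open>E1\<close> the abscissa of \<open>(P + Q) + R\<close> depends on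
      \<open>xQ\<close> and the slopes only. Exchanging \<open>P\<close> and \<open>R\<close> swaps
      \<open>l1\<close> with \<open>l2\<close> and \<open>l3\<close> with \<open>l4\<close>, which
      preserves this expression because \<open>l1 + l3 = l2 + l4\<close>.\<close>
    have U: "xU = xQ + (l1 + l3) * (l3 - l2)"
      using E1 SR(2) PQ(6) by algebra
    have TS: "xT - xS = (l1 - l2) * (l3 - l2)"
      using E1 PQ(6) QR(4) by algebra
    have x: "xU = xV" using sum U TS E1 PT(2) QR(4) by algebra
    have "yU = yV" using sum U TS PQ(7) SR(3) PT(3) QR(5) l1 l4 unfolding x[symmetric] by algebra
    with x show ?thesis using SR PT by simp
  qed (use S in auto)
qed

lemma comm_group_ec_group: "comm_group (ec_group A B)"
proof (rule comm_groupI)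
  show "\<exists>y\<in>carrier (ec_group A B). y \<otimes>\<^bsub>ec_group A B\<^esub> x = \<one>\<^bsub>ec_group A B\<^esub>"
    if "x \<in> carrier (ec_group A B)" for x
    using that by (intro bexI[of _ "ec_neg x"]) (auto simp: ec_group_def)
qed (auto simp: ec_group_def ec_add_closed ec_add_assoc intro: ec_add_commute)

end

section \<open>2-adic dynamics of doubling\<close>

text \<open>
  \<open>val2 q e\<close> says that the 2-adic valuation of \<open>q\<close> is \<open>e\<close>; \<open>val2_ge q e\<close> also admits \<open>q = 0\<close>.
\<close>

definition val2_ge :: "rat \<Rightarrow> int \<Rightarrow> bool" where
  "val2_ge q e \<longleftrightarrow> (\<exists>m n :: int. odd n \<and> q = 2 powi e * of_int m / of_int n)"

definition val2 :: "rat \<Rightarrow> int \<Rightarrow> bool" where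
  "val2 q e \<longleftrightarrow> (\<exists>m n :: int. odd m \<and> odd n \<and> q = 2 powi e * of_int m / of_int n)"

section \<open>Rules for 2-adic valuations\<close>

lemma val2_imp_ge: "val2 q e \<Longrightarrow> f \<le> e \<Longrightarrow> val2_ge q f"
proof -
  assume "val2 q e" "f \<le> e"
  then obtain m n :: int where mn: "odd n" "q = 2 powi e * of_int m / of_int n"
    unfolding val2_def by blast
  have "(2 :: rat) powi e = 2 powi f * 2 powi (e - f)"
    by (simp flip: power_int_add)
  also have "2 powi (e - f) = (of_int (2 ^ nat (e - f)) :: rat)"
    using \<open>f \<le> e\<close> by (simp add: power_int_def)
  finally have "q = 2 powi f * of_int (2 ^ nat (e - f) * m) / of_int n"
    using mn by simp
  with mn show ?thesis unfolding val2_ge_def by blast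
qed

lemma val2_nonzero: "val2 q e \<Longrightarrow> q \<noteq> 0"
  unfolding val2_def by fastforce

lemma val2_ge_0 [simp]: "val2_ge 0 e"
  unfolding val2_ge_def by (intro exI[of _ 0] exI[of _ 1]) simp

lemma val2_of_int: "odd m \<Longrightarrow> val2 (of_int m) 0"
  unfolding val2_def by (intro exI[of _ m] exI[of _ 1]) simp

lemma val2_mult:
  assumes "val2 q e" "val2 r f"
  shows "val2 (q * r) (e + f)"
proof -
  obtain m n m' n' :: int where "odd m" "odd n" "odd m'" "odd n'"
    "q = 2 powi e * of_int m / of_int n" "r = 2 powi f * of_int m' / of_int n'"
    using assms unfolding val2_def by blast
  then have "q * r = 2 powi (e + f) * of_int (m * m') / of_int (n * n')"
    "odd (m * m')" "odd (n * n')"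
    by (simp_all add: power_int_add)
  then show ?thesis unfolding val2_def by blast
qed

lemma val2_ge_mult:
  assumes "val2_ge q e" "val2_ge r f"
  shows "val2_ge (q * r) (e + f)"
proof -
  obtain m n m' n' :: int where "odd n" "odd n'"
    "q = 2 powi e * of_int m / of_int n" "r = 2 powi f * of_int m' / of_int n'"
    using assms unfolding val2_ge_def by blast
  then have "q * r = 2 powi (e + f) * of_int (m * m') / of_int (n * n')" "odd (n * n')"
    by (simp_all add: power_int_add)
  then show ?thesis unfolding val2_ge_def by blast
qed

lemma val2_power2: "val2 (2 ^ n) (int n)"
  unfolding val2_def by (intro exI[of _ 1]) simp

lemma val2_power: "val2 q e \<Longrightarrow> val2 (q ^ n) (int n * e)"
proof (induction n)
  case 0
  show ?case using val2_of_int[of 1] by simp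
next
  case (Suc n)
  then show ?case using val2_mult[of q e "q ^ n" "int n * e"] by (simp add: algebra_simps)
qed

lemma val2_divide:
  assumes "val2 q e" "val2 r f"
  shows "val2 (q / r) (e - f)"
proof -
  obtain m n m' n' :: int where "odd m" "odd n" "odd m'" "odd n'"
    "q = 2 powi e * of_int m / of_int n" "r = 2 powi f * of_int m' / of_int n'"
    using assms unfolding val2_def by blast
  then have "q / r = 2 powi (e - f) * of_int (m * n') / of_int (n * m')"
    "odd (m * n')" "odd (n * m')"
    by (simp_all add: power_int_diff mult_ac)
  then show ?thesis unfolding val2_def by blast
qed

lemma val2_ge_add:
  assumes "val2_ge q e" "val2_ge r e"
  shows "val2_ge (q + r) e"
proof -
  obtain m n m' n' :: int where *: "odd n" "odd n'"
    "q = 2 powi e * of_int m / of_int n" "r = 2 powi e * of_int m' / of_int n'"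
    using assms unfolding val2_ge_def by blast
  then have "n \<noteq> 0" "n' \<noteq> 0" by auto
  with * have "q + r = 2 powi e * of_int (m * n' + m' * n) / of_int (n * n')" "odd (n * n')"
    by (simp_all add: field_simps)
  then show ?thesis unfolding val2_ge_def by blast
qed

lemma val2_add:
  assumes "val2 q e" "val2_ge r f" "e < f"
  shows "val2 (q + r) e"
proof -
  obtain m n m' n' :: int where *: "odd m" "odd n" "odd n'"
    "q = 2 powi e * of_int m / of_int n" "r = 2 powi f * of_int m' / of_int n'"
    using assms unfolding val2_def val2_ge_def by blast
  have "(2 :: rat) powi f = 2 powi e * 2 powi (f - e)"
    by (simp flip: power_int_add)
  also have "2 powi (f - e) = (of_int (2 ^ nat (f - e)) :: rat)"
    using \<open>e < f\<close> by (simp add: power_int_def)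
  finally have "r = 2 powi e * of_int (2 ^ nat (f - e) * m') / of_int n'"
    using * by simp
  moreover have "n \<noteq> 0" "n' \<noteq> 0" using * by auto
  ultimately have "q + r = 2 powi e * of_int (m * n' + 2 ^ nat (f - e) * m' * n) / of_int (n * n')"
    using * by (simp add: field_simps)
  moreover have "odd (n * n')" "odd (m * n' + 2 ^ nat (f - e) * m' * n)"
    using * \<open>e < f\<close> by simp_all
  ultimately show ?thesis unfolding val2_def by blast
qed

text \<open>Special to the prime 2: the residue field has two elements, so equal leading terms
  always cancel.\<close>

lemma val2_add_same:
  assumes "val2 q e" "val2 r e"
  shows "val2_ge (q + r) (e + 1)"
proof -
  obtain m n m' n' :: int where *: "odd m" "odd n" "odd m'" "odd n'"
    "q = 2 powi e * of_int m / of_int n" "r = 2 powi e * of_int m' / of_int n'"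
    using assms unfolding val2_def val2_ge_def by blast
  then have "even (m * n' + m' * n)" by simp
  then obtain k where k: "m * n' + m' * n = 2 * k" by (elim evenE)
  have "n \<noteq> 0" "n' \<noteq> 0" using * by auto
  then have "q + r = 2 powi e * of_int (m * n' + m' * n) / of_int (n * n')"
    using * by (simp add: field_simps)
  then have "q + r = 2 powi (e + 1) * of_int k / of_int (n * n')"
    unfolding k by (simp add: power_int_add)
  moreover have "odd (n * n')" using * by simp
  ultimately show ?thesis unfolding val2_ge_def by blast
qed

lemma val2_geE:
  assumes "val2_ge q e"
  obtains "q = 0" | f where "e \<le> f" "val2 q f"
proof (cases "q = 0")
  case False
  obtain m n :: int where *: "odd n" "q = 2 powi e * of_int m / of_int n"
    using assms unfolding val2_ge_def by blast
  with False have "m \<noteq> 0" by auto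
  then obtain k where k: "m = 2 ^ multiplicity 2 m * k" "odd k"
    using multiplicity_decompose'[of m 2] by auto
  have "q = 2 powi (e + int (multiplicity 2 m)) * of_int k / of_int n"
    unfolding *(2) by (subst k(1)) (simp add: power_int_add)
  with * k(2) have v: "val2 q (e + int (multiplicity 2 m))"
    unfolding val2_def by blast
  show ?thesis by (rule that(2)[OF _ v]) simp
qed (use that in auto)

lemma val2_ge_mono: "val2_ge q e \<Longrightarrow> f \<le> e \<Longrightarrow> val2_ge q f"
  by (erule val2_geE) (auto intro: val2_imp_ge order_trans)

lemma val2_exists:
  assumes "q \<noteq> 0"
  obtains e where "val2 q e"
proof -
  obtain m n :: int where q: "q = of_int m / of_int n" "n > 0"
    by (metis quotient_of_div quotient_of_denom_pos prod.collapse)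
  have "val2_ge (of_int m) 0" "val2_ge (of_int n) 0"
    unfolding val2_ge_def by (intro exI[of _ 1] exI; simp)+
  moreover have "(of_int m :: rat) \<noteq> 0" "(of_int n :: rat) \<noteq> 0" using q assms by auto
  ultimately obtain e f where "val2 (of_int m) e" "val2 (of_int n) f"
    by (metis val2_geE)
  then have "val2 q (e - f)" unfolding q by (rule val2_divide)
  then show ?thesis by (rule that)
qed

text \<open>Otherwise \<open>q + (- q)\<close> would have valuation \<open>e\<close>, although it is
  0.\<close>

lemma val2_less_imp_False:
  assumes "val2 q e" "val2 q f" "e < f"
  shows False
proof -
  have "val2 1 0" using val2_of_int[of 1] by simp
  moreover have "val2_ge (- 1) 0" unfolding val2_ge_def by (intro exI[of _ "-1"] exI[of _ 1]) simp
  moreover have "val2_ge (-1 * q) (0 + f)"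
    using calculation assms by (intro val2_ge_mult val2_imp_ge[of q f]) simp_all
  ultimately have "val2 (q + - 1 * q) e" using assms by (intro val2_add[of _ _ _ f]) simp_all
  then show False using val2_nonzero by fastforce
qed

lemma val2_unique: "val2 q e \<Longrightarrow> val2 q f \<Longrightarrow> e = f"
  using val2_less_imp_False[of q e f] val2_less_imp_False[of q f e] by (cases e f rule: linorder_cases) auto

text \<open>The action of doubling on \<open>t = x\<^sup>3 / a\<close> for points of \<open>y\<^sup>2 = x\<^sup>3 + a\<close>.\<close>

definition dbl_cube :: "rat \<Rightarrow> rat" where
  "dbl_cube t = t * (t - 8) ^ 3 / (64 * (t + 1) ^ 3)"

lemma val2_dbl_cube:
  assumes "val2 t e" "val2 (t - 8) f" "val2 (t + 1) g"
  shows "val2 (dbl_cube t) (e + 3 * f - 6 - 3 * g)"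
proof -
  have "val2 (dbl_cube t) ((e + int 3 * f) - (int 6 + int 3 * g))"
    unfolding dbl_cube_def using val2_power2[of 6] assms
    by (intro val2_divide val2_mult val2_power) simp_all
  then show ?thesis by (simp add: algebra_simps)
qed

text \<open>\<open>3456\<close>, \<open>-1728\<close> and \<open>216\<close> are the coefficients of
  the numerator of \<open>dbl_cube t + 4\<close> expanded at \<open>t = -4\<close>; the other
  numbers occur in \<open>t + 1\<close>, \<open>t + 4\<close>, \<open>t - 8\<close> and the
  denominator of \<open>dbl_cube\<close>.\<close>

lemma val2_numerals:
  "val2 1 0" "val2 4 2" "val2 (- 8) 3" "val2 64 6" "val2 3456 7" "val2 (-1728) 6" "val2 216 3"
proof -
  have *: "val2 (2 ^ n * of_int m) (int n)" if "odd m" for n m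
    using val2_mult[OF val2_power2[of n] val2_of_int[OF that]] by simp
  show "val2 1 0" "val2 4 2" "val2 (- 8) 3" "val2 64 6" "val2 3456 7" "val2 (-1728) 6" "val2 216 3"
    using *[of 1 0] *[of 1 2] *[of "-1" 3] *[of 1 6] *[of 27 7] *[of "-27" 6] *[of 27 3] by simp_all
qed

section \<open>Valuation of \<open>dbl_cube t\<close> in terms of the valuation of
  \<open>t\<close>\<close>

lemma val2_plus_1_neg: "val2 t e \<Longrightarrow> e < 0 \<Longrightarrow> val2 (t + 1) e"
  by (rule val2_add[OF _ val2_imp_ge[OF val2_numerals(1)], of _ _ 0]) auto

lemma val2_plus_1_pos: "val2 t e \<Longrightarrow> e > 0 \<Longrightarrow> val2 (t + 1) 0"
  using val2_add[OF val2_numerals(1) val2_imp_ge[of t e e]] by (simp add: add.commute)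

lemma val2_minus_8_less: "val2 t e \<Longrightarrow> e < 3 \<Longrightarrow> val2 (t - 8) e"
  using val2_add[OF _ val2_imp_ge[OF val2_numerals(3)], of t e 3] by simp

lemma val2_minus_8_greater: "val2 t e \<Longrightarrow> e > 3 \<Longrightarrow> val2 (t - 8) 3"
  using val2_add[OF val2_numerals(3) val2_imp_ge[of t e e]] by simp

lemma dbl_cube_neg: "val2 t e \<Longrightarrow> e < 0 \<Longrightarrow> val2 (dbl_cube t) (e - 6)"
  using val2_dbl_cube[OF _ val2_minus_8_less val2_plus_1_neg, of t e e e] by (simp add: add.commute)

text \<open>Here \<open>t\<close> and \<open>t - 8\<close> are units while \<open>t + 1\<close> is
  even, so the denominator prevails.\<close>

lemma dbl_cube_0:
  assumes "val2 t 0" "t \<noteq> -1"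
  obtains f where "f < 0" "val2 (dbl_cube t) f"
proof -
  have "t + 1 \<noteq> 0" using assms(2) by (simp add: add_eq_0_iff2)
  then obtain g where g: "g \<ge> 1" "val2 (t + 1) g"
    using val2_add_same[OF assms(1) val2_numerals(1)] by (auto elim: val2_geE)
  then have "val2 (dbl_cube t) (0 + 3 * 0 - 6 - 3 * g)"
    using assms(1) by (intro val2_dbl_cube val2_minus_8_less) simp_all
  with g show ?thesis by (intro that) simp_all
qed

lemma dbl_cube_1: "val2 t 1 \<Longrightarrow> val2 (dbl_cube t) (- 2)"
  using val2_dbl_cube[OF _ val2_minus_8_less val2_plus_1_pos, of t 1 1 1] by simp

text \<open>\<open>t\<close> and \<open>8\<close> have equal valuation, so \<open>t - 8\<close> has
  valuation at least 4 and its cube makes the numerator prevail.\<close>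

lemma dbl_cube_3:
  assumes "val2 t 3" "t \<noteq> 8"
  obtains f where "f \<ge> 4" "val2 (dbl_cube t) f"
proof -
  have "t - 8 \<noteq> 0" using assms(2) by simp
  then obtain g where g: "g \<ge> 4" "val2 (t - 8) g"
    using val2_add_same[OF assms(1) val2_numerals(3)] by (auto elim: val2_geE)
  then have "val2 (dbl_cube t) (3 + 3 * g - 6 - 3 * 0)"
    using assms(1) by (intro val2_dbl_cube val2_plus_1_pos[of t 3]) simp_all
  with g show ?thesis by (intro that) simp_all
qed

lemma dbl_cube_ge4: "val2 t e \<Longrightarrow> e \<ge> 4 \<Longrightarrow> val2 (dbl_cube t) (e + 3)"
  using val2_dbl_cube[OF _ val2_minus_8_greater val2_plus_1_pos, of t e e e] by (simp add: add.commute)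

text \<open>Doubling contracts 2-adically towards its fixed point \<open>-4\<close>, a point of order 3.\<close>

lemma dbl_cube_2:
  assumes t: "val2 t 2" and g: "val2 (t + 4) g"
  shows "val2 (dbl_cube t) 2" "val2 (dbl_cube t + 4) (g + 1)"
proof -
  have t1: "val2 (t + 1) 0" using t by (rule val2_plus_1_pos) simp
  show "val2 (dbl_cube t) 2"
    using val2_dbl_cube[OF t val2_minus_8_less[OF t] t1] by simp
  have "t + 4 \<noteq> 0" using g val2_nonzero by blast
  then obtain g' where "g' \<ge> 3" "val2 (t + 4) g'"
    using val2_add_same[OF t val2_numerals(2)] by (auto elim: val2_geE)
  with g have "g \<ge> 3" using val2_unique by blast
  define d where "d = t + 4"
  have d: "val2_ge d 3" using g \<open>g \<ge> 3\<close> unfolding d_def by (rule val2_imp_ge)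
  \<comment> \<open>The numerator of \<open>dbl_cube t + 4\<close> is \<open>d * (3456 + r)\<close>.
    As \<open>8\<close> divides \<open>d\<close>, the term \<open>3456\<close> of valuation 7
    dominates \<open>r\<close>; against valuation 6 of the denominator this gains exactly 1.\<close>
  define r where "r = d * (- 1728 + d * (216 + d))"
  have "val2_ge r (3 + 5)"
    unfolding r_def
  proof (intro val2_ge_mult d val2_ge_add)
    show "val2_ge (- 1728) 5" using val2_numerals(6) by (rule val2_imp_ge) simp
    have "val2_ge (d * (216 + d)) (3 + 3)"
      using val2_numerals(7) by (intro val2_ge_mult d val2_ge_add val2_imp_ge[of _ 3]) simp_all
    then show "val2_ge (d * (216 + d)) 5" by (rule val2_ge_mono) simp
  qed
  then have r: "val2 (3456 + r) 7"
    using val2_numerals(5) by (intro val2_add[of _ _ _ 8]) simp_all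
  have "t + 1 \<noteq> 0" using t1 val2_nonzero by blast
  then have "dbl_cube t + 4 = (t + 4) * (3456 + r) / (64 * (t + 1) ^ 3)"
    unfolding dbl_cube_def r_def d_def by (simp add: divide_simps) algebra
  also have "val2 \<dots> ((g + 7) - (6 + int 3 * 0))"
    using val2_numerals(4) by (intro val2_divide val2_mult val2_power g r t1)
  finally show "val2 (dbl_cube t + 4) (g + 1)" by (simp add: add.commute)
qed

section \<open>Finite abelian groups\<close>

lemma (in group) nat_pow_mod:
  assumes "x \<in> carrier G" "x [^] (n :: nat) = \<one>"
  shows "x [^] (m mod n) = x [^] m"
proof -
  have "x [^] m = x [^] (n * (m div n) + m mod n)" by simp
  also have "\<dots> = (x [^] n) [^] (m div n) \<otimes> x [^] (m mod n)"
    using assms(1) by (simp only: nat_pow_mult[symmetric] nat_pow_pow nat_pow_closed)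
  also have "\<dots> = x [^] (m mod n)" using assms by simp
  finally show ?thesis by simp
qed

text \<open>Read \<open>R e P\<close> as "\<open>P\<close> has height \<open>e\<close>". Doubling
  raises the height, so the elements \<open>2 ^ k * P\<close> are pairwise distinct, whereas the
  multiples of a torsion element form a finite set. A relation is used because only some elements
  have a height.\<close>

lemma (in group) infinite_order_if_increasing:
  fixes R :: "int \<Rightarrow> 'a \<Rightarrow> bool"
  assumes step: "\<And>e P. P \<in> carrier G \<Longrightarrow> R e P \<Longrightarrow> \<exists>f>e. R f (P \<otimes> P)"
    and uniq: "\<And>e f P. R e P \<Longrightarrow> R f P \<Longrightarrow> e = f"
    and P: "P \<in> carrier G" "R e P" and n: "n > 0" "P [^] (n :: nat) = \<one>"
  shows False
proof -
  let ?f = "\<lambda>k :: nat. P [^] (2 ^ k :: nat)"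
  have carr: "?f k \<in> carrier G" for k using P by simp
  have Suc: "?f (Suc k) = ?f k \<otimes> ?f k" for k
    using P by (simp add: nat_pow_mult mult_2)
  have "\<exists>e. R e (?f k)" for k
  proof (induction k)
    case 0
    then show ?case using P by auto
  next
    case (Suc k)
    then show ?case using step[OF carr[of k]] unfolding \<open>?f (Suc k) = ?f k \<otimes> ?f k\<close> by blast
  qed
  then obtain M where M: "R (M k) (?f k)" for k by metis
  have "M k < M (Suc k)" for k
  proof -
    obtain f where "f > M k" "R f (?f (Suc k))"
      using step[OF carr M[of k]] unfolding Suc by blast
    with uniq[OF _ M[of "Suc k"]] show ?thesis by blast
  qed
  then have "strict_mono M" by (simp add: strict_mono_Suc_iff)
  have "inj ?f"
  proof (rule injI)
    fix i j assume "?f i = ?f j"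
    then have "M i = M j" using M uniq by metis
    then show "i = j" using \<open>strict_mono M\<close> by (simp add: strict_mono_eq)
  qed
  moreover have "range ?f \<subseteq> (\<lambda>i. P [^] i) ` {..<n}"
  proof
    fix Q assume "Q \<in> range ?f"
    then obtain m :: nat where "Q = P [^] m" by blast
    also have "P [^] m = P [^] (m mod n)" using nat_pow_mod P(1) n(2) by simp
    finally show "Q \<in> (\<lambda>i. P [^] i) ` {..<n}" using n by simp
  qed
  then have "finite (range ?f)" by (rule finite_subset) simp
  ultimately show False using range_inj_infinite by blast
qed

lemma (in group) hom_integer_mod_group:
  assumes "x \<in> carrier G" "x [^] (n :: nat) = \<one>" "n > 0"
  shows "(\<lambda>i. x [^] nat i) \<in> hom (integer_mod_group n) G"
proof (rule homI)
  fix i j assume "i \<in> carrier (integer_mod_group n)" "j \<in> carrier (integer_mod_group n)"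
  then have "0 \<le> i" "0 \<le> j" using assms(3) by (auto simp: carrier_integer_mod_group)
  then have "nat ((i + j) mod int n) = (nat i + nat j) mod n"
    by (simp add: nat_mod_distrib nat_add_distrib)
  then show "x [^] nat (i \<otimes>\<^bsub>integer_mod_group n\<^esub> j) = x [^] nat i \<otimes> x [^] nat j"
    using assms(1) nat_pow_mod[OF assms(1,2), of "nat i + nat j"] by (simp add: nat_pow_mult)
qed (use assms in simp)

text \<open>An injection into a finite set that is not larger is onto. So later an upper bound for
  the torsion subgroup and independent elements are enough, and surjectivity is never
  checked.\<close>

lemma is_iso_if_card_le:
  assumes "group G" "group H" "h \<in> hom G H"
    and ker: "\<And>x. x \<in> carrier G \<Longrightarrow> h x = \<one>\<^bsub>H\<^esub> \<Longrightarrow> x = \<one>\<^bsub>G\<^esub>"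
    and fin: "finite (carrier H)" "card (carrier H) \<le> card (carrier G)"
  shows "H \<cong> G"
proof -
  have inj: "inj_on h (carrier G)"
    using inj_on_one_iff'[OF assms(3,1,2)] ker by blast
  have sub: "h ` carrier G \<subseteq> carrier H" using assms(3) by (auto simp: hom_def)
  have "h ` carrier G = carrier H"
    using card_seteq[OF fin(1) sub] fin(2) card_image[OF inj] by simp
  with inj assms(3) have "h \<in> iso G H" by (simp add: iso_def bij_betw_def)
  then show ?thesis using group.iso_sym[OF assms(1)] is_isoI by blast
qed

lemma (in group) iso_integer_mod_group:
  assumes x: "x \<in> carrier G" "x [^] (n :: nat) = \<one>" "n > 0"
    and ker: "\<And>i :: nat. i < n \<Longrightarrow> x [^] i = \<one> \<Longrightarrow> i = 0"
    and fin: "finite (carrier G)" "card (carrier G) \<le> n"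
  shows "G \<cong> integer_mod_group n"
proof (rule is_iso_if_card_le[OF _ is_group hom_integer_mod_group[OF x]])
  fix i assume "i \<in> carrier (integer_mod_group n)" "x [^] nat i = \<one>"
  then show "i = \<one>\<^bsub>integer_mod_group n\<^esub>"
    using ker[of "nat i"] x(3) by (auto simp: carrier_integer_mod_group)
qed (use fin x(3) in \<open>simp_all add: carrier_integer_mod_group\<close>)

lemma (in comm_monoid) m_interchange:
  assumes "a \<in> carrier G" "b \<in> carrier G" "c \<in> carrier G" "d \<in> carrier G"
  shows "(a \<otimes> b) \<otimes> (c \<otimes> d) = (a \<otimes> c) \<otimes> (b \<otimes> d)"
  using assms m_lcomm[of b c d] by (simp add: m_assoc)

lemma (in comm_group) iso_integer_mod_group_Times:
  assumes x: "x \<in> carrier G" "x [^] (n :: nat) = \<one>" "n > 0"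
    and y: "y \<in> carrier G" "y [^] (m :: nat) = \<one>" "m > 0"
    and ker: "\<And>i j :: nat. i < n \<Longrightarrow> j < m \<Longrightarrow> x [^] i \<otimes> y [^] j = \<one> \<Longrightarrow> i = 0 \<and> j = 0"
    and fin: "finite (carrier G)" "card (carrier G) \<le> n * m"
  shows "G \<cong> integer_mod_group n \<times>\<times> integer_mod_group m"
proof (rule is_iso_if_card_le[OF _ is_group])
  let ?h = "\<lambda>(i, j). x [^] nat i \<otimes> y [^] nat j"
  note hx = hom_integer_mod_group[OF x] and hy = hom_integer_mod_group[OF y]
  show "group (integer_mod_group n \<times>\<times> integer_mod_group m)"
    by (intro DirProd_group) simp_all
  show "?h \<in> hom (integer_mod_group n \<times>\<times> integer_mod_group m) G"
  proof (rule homI)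
    fix u v assume uv: "u \<in> carrier (integer_mod_group n \<times>\<times> integer_mod_group m)"
      "v \<in> carrier (integer_mod_group n \<times>\<times> integer_mod_group m)"
    obtain i j k l where eq [simp]: "u = (i, j)" "v = (k, l)" by (metis surj_pair)
    have "x [^] nat ((i + k) mod int n) = x [^] nat i \<otimes> x [^] nat k"
      using hom_mult[OF hx, of i k] uv by simp
    moreover have "y [^] nat ((j + l) mod int m) = y [^] nat j \<otimes> y [^] nat l"
      using hom_mult[OF hy, of j l] uv by simp
    ultimately have "?h (u \<otimes>\<^bsub>integer_mod_group n \<times>\<times> integer_mod_group m\<^esub> v)
        = (x [^] nat i \<otimes> x [^] nat k) \<otimes> (y [^] nat j \<otimes> y [^] nat l)"
      by simp
    also have "\<dots> = (x [^] nat i \<otimes> y [^] nat j) \<otimes> (x [^] nat k \<otimes> y [^] nat l)"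
      using x(1) y(1) by (intro m_interchange nat_pow_closed)
    finally show "?h (u \<otimes>\<^bsub>integer_mod_group n \<times>\<times> integer_mod_group m\<^esub> v) = ?h u \<otimes> ?h v"
      by (simp only: eq case_prod_conv)
  qed (use x(1) y(1) in \<open>auto\<close>)
  fix u assume u: "u \<in> carrier (integer_mod_group n \<times>\<times> integer_mod_group m)" "?h u = \<one>"
  obtain i j where eq [simp]: "u = (i, j)" by fastforce
  have "0 \<le> i" "i < int n" "0 \<le> j" "j < int m"
    using u(1) x(3) y(3) by (simp_all add: carrier_integer_mod_group)
  then have "nat i < n" "nat j < m" by simp_all
  moreover have "x [^] nat i \<otimes> y [^] nat j = \<one>" using u(2) by (simp only: eq case_prod_conv)
  ultimately have "nat i = 0 \<and> nat j = 0" by (rule ker)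
  with \<open>0 \<le> i\<close> \<open>0 \<le> j\<close> show "u = \<one>\<^bsub>integer_mod_group n \<times>\<times> integer_mod_group m\<^esub>"
    by simp
next
  show "finite (carrier G)" "card (carrier G) \<le> card (carrier (integer_mod_group n \<times>\<times> integer_mod_group m))"
    using fin x(3) y(3) by (simp_all add: carrier_integer_mod_group card_cartesian_product)
qed

section \<open>The torsion subgroup of an abelian group\<close>

lemma torsion_subgroup_simps [simp]:
  "carrier (torsion_subgroup G) = {P \<in> carrier G. \<exists>n :: nat. n > 0 \<and> P [^]\<^bsub>G\<^esub> n = \<one>\<^bsub>G\<^esub>}"
  "x \<otimes>\<^bsub>torsion_subgroup G\<^esub> y = x \<otimes>\<^bsub>G\<^esub> y" "\<one>\<^bsub>torsion_subgroup G\<^esub> = \<one>\<^bsub>G\<^esub>"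
  by (simp_all add: torsion_subgroup_def)

lemma pow_torsion_subgroup [simp]: "x [^]\<^bsub>torsion_subgroup G\<^esub> (n :: nat) = x [^]\<^bsub>G\<^esub> n"
  by (simp add: nat_pow_def)

lemma (in comm_group) comm_group_torsion_subgroup: "comm_group (torsion_subgroup G)"
proof (rule comm_groupI)
  fix x y assume "x \<in> carrier (torsion_subgroup G)" "y \<in> carrier (torsion_subgroup G)"
  then obtain m n :: nat where *: "x \<in> carrier G" "y \<in> carrier G" "m > 0" "n > 0"
    "x [^] m = \<one>" "y [^] n = \<one>" by auto
  have "x [^] (m * n) = (x [^] m) [^] n" "y [^] (m * n) = (y [^] n) [^] m"
    using nat_pow_pow[OF *(1), of m n] nat_pow_pow[OF *(2), of n m] by (simp_all only: mult.commute)
  then have "x [^] (m * n) = \<one>" "y [^] (m * n) = \<one>"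
    using *(5,6) by simp_all
  then have "(x \<otimes> y) [^] (m * n) = \<one>"
    using pow_mult_distrib[OF m_comm[OF *(1,2)] *(1,2), of "m * n"] by simp
  moreover have "m * n > 0" using *(3,4) by simp
  ultimately show "x \<otimes>\<^bsub>torsion_subgroup G\<^esub> y \<in> carrier (torsion_subgroup G)"
    unfolding torsion_subgroup_simps using m_closed[OF *(1,2)] by blast
next
  fix x assume "x \<in> carrier (torsion_subgroup G)"
  then obtain n :: nat where *: "x \<in> carrier G" "n > 0" "x [^] n = \<one>" by auto
  then have "inv x [^] n = \<one>" by (simp add: nat_pow_inv)
  then have "inv x \<in> carrier (torsion_subgroup G)"
    unfolding torsion_subgroup_simps using * by blast
  then show "\<exists>y\<in>carrier (torsion_subgroup G).
      y \<otimes>\<^bsub>torsion_subgroup G\<^esub> x = \<one>\<^bsub>torsion_subgroup G\<^esub>"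
    by (rule bexI[rotated]) (use * in simp)
next
  show "\<one>\<^bsub>torsion_subgroup G\<^esub> \<in> carrier (torsion_subgroup G)"
    by (auto intro: exI[of _ 1])
qed (auto simp: m_ac)

section \<open>Torsion points with rational abscissa\<close>

lemma ec_group_simps [simp]:
  "carrier (ec_group A B) = ec_points A B" "x \<otimes>\<^bsub>ec_group A B\<^esub> y = ec_add A x y"
  "\<one>\<^bsub>ec_group A B\<^esub> = Infinity"
  by (simp_all add: ec_group_def)

locale mordell_curve =
  fixes a :: "'k :: field_char_0"
  assumes a_nonzero: "a \<noteq> 0"
begin

sublocale elliptic_curve 0 a
  by unfold_locales (use a_nonzero in auto)

abbreviation E :: "'k point monoid" where "E \<equiv> ec_group 0 a"

sublocale E: comm_group E
  by (rule comm_group_ec_group)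

lemma inv_E: "P \<in> ec_points 0 a \<Longrightarrow> inv\<^bsub>E\<^esub> P = ec_neg P"
  by (rule E.inv_equality) simp_all

lemma torsion_mult:
  assumes "P \<in> ec_points 0 a" "P [^]\<^bsub>E\<^esub> (n :: nat) = Infinity"
  shows "(P [^]\<^bsub>E\<^esub> (m :: nat)) [^]\<^bsub>E\<^esub> n = Infinity"
  using assms E.nat_pow_pow[of P m n] E.nat_pow_pow[of P n m] E.nat_pow_one[of m]
  by (simp add: mult.commute)

lemma pow_Infinity: "Infinity [^]\<^bsub>E\<^esub> (n :: nat) = Infinity"
  using E.nat_pow_one[of n] by simp

lemma pow_closed: "P \<in> ec_points 0 a \<Longrightarrow> P [^]\<^bsub>E\<^esub> (n :: nat) \<in> ec_points 0 a"
  using E.nat_pow_closed[of P n] by simp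

lemma pow_pow: "P \<in> ec_points 0 a \<Longrightarrow> (P [^]\<^bsub>E\<^esub> (m :: nat)) [^]\<^bsub>E\<^esub> (n :: nat) = P [^]\<^bsub>E\<^esub> (m * n)"
  using E.nat_pow_pow[of P m n] by simp

lemma pow_add: "P \<in> ec_points 0 a \<Longrightarrow>
    ec_add 0 (P [^]\<^bsub>E\<^esub> (m :: nat)) (P [^]\<^bsub>E\<^esub> (n :: nat)) = P [^]\<^bsub>E\<^esub> (m + n)"
  using E.nat_pow_mult[of P m n] by simp

lemma pow2: "P \<in> ec_points 0 a \<Longrightarrow> P [^]\<^bsub>E\<^esub> (2 :: nat) = ec_add 0 P P"
  by (simp add: numeral_2_eq_2)

text \<open>The tangent formulas with denominators cleared, as needed for polynomial reasoning; the
  curve equation has been used to shorten the first.\<close>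

lemma doubling:
  assumes "Affine x y \<in> ec_points 0 a" "y \<noteq> 0"
  obtains x' y' where "ec_add 0 (Affine x y) (Affine x y) = Affine x' y'"
    "4 * y ^ 2 * x' = x * (x ^ 3 - 8 * a)" "2 * y * y' = 3 * x ^ 2 * (x - x') - 2 * y ^ 2"
proof -
  define l where "l = 3 * x ^ 2 / (2 * y)"
  have l: "2 * y * l = 3 * x ^ 2" unfolding l_def using assms(2) by simp
  have "ec_add 0 (Affine x y) (Affine x y) =
      Affine (l ^ 2 - x - x) (l * (x - (l ^ 2 - x - x)) - y)"
    using assms(2) by (simp add: Let_def l_def)
  moreover have "4 * y ^ 2 * (l ^ 2 - x - x) = x * (x ^ 3 - 8 * a)"
    using l assms(1) by simp algebra
  moreover have "2 * y * (l * (x - (l ^ 2 - x - x)) - y)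
      = 3 * x ^ 2 * (x - (l ^ 2 - x - x)) - 2 * y ^ 2"
    using l by algebra
  ultimately show ?thesis by (rule that)
qed

lemma pow2_eq_Infinity_iff:
  assumes "Affine x y \<in> ec_points 0 a"
  shows "Affine x y [^]\<^bsub>E\<^esub> (2 :: nat) = Infinity \<longleftrightarrow> y = 0"
proof (cases "y = 0")
  case False
  then show ?thesis using doubling[OF assms False] pow2[OF assms] by (metis point.distinct(1))
qed (use assms in \<open>simp add: pow2\<close>)

text \<open>\<open>3 * x * (x ^ 3 + 4 * a)\<close> is the third division polynomial.
  \<open>3 P = 0\<close> means \<open>2 P = -P\<close>, for which equal abscissas suffice:
  \<open>x' = x\<close> forces \<open>y' = - y\<close>. If \<open>y = 0\<close>, both sides are
  false.\<close>

lemma pow3_eq_Infinity_iff: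
  assumes P: "Affine x y \<in> ec_points 0 a"
  shows "Affine x y [^]\<^bsub>E\<^esub> (3 :: nat) = Infinity \<longleftrightarrow> x * (x ^ 3 + 4 * a) = 0"
proof -
  let ?P = "Affine x y"
  have curve: "y ^ 2 = x ^ 3 + a" using P by simp
  have "?P [^]\<^bsub>E\<^esub> (3 :: nat) = ec_add 0 (ec_add 0 ?P ?P) ?P"
    by (simp only: numeral_3_eq_3 E.nat_pow_Suc E.nat_pow_0 ec_group_simps) simp
  also have "\<dots> = Infinity \<longleftrightarrow> ec_add 0 ?P ?P = ec_neg ?P"
    using E.inv_equality[of "ec_add 0 ?P ?P" ?P] inv_E[OF P] P ec_add_closed[OF P P]
    by (auto simp del: ec_add.simps ec_neg.simps)
  also have "\<dots> \<longleftrightarrow> x * (x ^ 3 + 4 * a) = 0"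
  proof (cases "y = 0")
    case True
    then have "x ^ 3 = - a" using curve by (simp add: eq_neg_iff_add_eq_0)
    then show ?thesis using True a_nonzero by auto
  next
    case False
    obtain x' y' where *: "ec_add 0 ?P ?P = Affine x' y'"
      "4 * y ^ 2 * x' = x * (x ^ 3 - 8 * a)" "2 * y * y' = 3 * x ^ 2 * (x - x') - 2 * y ^ 2"
      using doubling[OF P False] by blast
    have "4 * y ^ 2 * (x - x') = 3 * (x * (x ^ 3 + 4 * a))"
      using *(2) curve by algebra
    then have "x' = x \<longleftrightarrow> x * (x ^ 3 + 4 * a) = 0"
      using False by (auto simp: right_minus_eq)
    moreover have "y' = - y" if "x' = x"
    proof -
      have "2 * y * (y' + y) = 0" using *(3) unfolding that by algebra
      then show ?thesis using False by (simp add: eq_neg_iff_add_eq_0)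
    qed
    ultimately show ?thesis using *(1) by (auto simp del: ec_add.simps)
  qed
  finally show ?thesis .
qed

text \<open>Cubing the abscissa formula of \<open>doubling\<close> turns it into a relation between
  values of \<open>t\<close>, since \<open>y ^ 2 = (t + 1) * a\<close>. The condition on
  \<open>t\<close> says \<open>y \<noteq> 0\<close>, so that the double is affine.\<close>

lemma doubling_cube:
  assumes P: "Affine x y \<in> ec_points 0 a" and t: "x ^ 3 = of_rat t * a" and "t \<noteq> -1"
  obtains x' y' where "ec_add 0 (Affine x y) (Affine x y) = Affine x' y'"
    "Affine x' y' \<in> ec_points 0 a" "x' ^ 3 = of_rat (dbl_cube t) * a"
proof -
  let ?t = "of_rat t :: 'k"
  have y: "y ^ 2 = (?t + 1) * a" using P t by (simp add: algebra_simps)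
  have "?t + 1 \<noteq> 0"
  proof
    assume "?t + 1 = 0"
    then have "of_rat (t + 1) = (0 :: 'k)" by (simp add: of_rat_add)
    with \<open>t \<noteq> -1\<close> show False by (simp add: eq_neg_iff_add_eq_0)
  qed
  then have "y \<noteq> 0" using y a_nonzero by auto
  then obtain x' y' where *: "ec_add 0 (Affine x y) (Affine x y) = Affine x' y'"
    "4 * y ^ 2 * x' = x * (x ^ 3 - 8 * a)"
    using doubling[OF P] by blast
  have "4 * (?t + 1) * a * x' = x * ((?t - 8) * a)"
    using *(2) t y by (simp add: algebra_simps)
  then have "4 * (?t + 1) * x' = x * (?t - 8)"
    using a_nonzero by simp
  then have "64 * (?t + 1) ^ 3 * x' ^ 3 = x ^ 3 * (?t - 8) ^ 3"
    by algebra
  then have "x' ^ 3 = ?t * (?t - 8) ^ 3 / (64 * (?t + 1) ^ 3) * a"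
    unfolding t using \<open>?t + 1 \<noteq> 0\<close> by (simp add: field_simps)
  moreover have "of_rat (dbl_cube t) = ?t * (?t - 8) ^ 3 / (64 * (?t + 1) ^ 3)"
    unfolding dbl_cube_def by (simp add: of_rat_divide of_rat_mult of_rat_power of_rat_diff of_rat_add)
  ultimately have "x' ^ 3 = of_rat (dbl_cube t) * a" by simp
  moreover have "Affine x' y' \<in> ec_points 0 a"
    using ec_add_closed[OF P P] *(1) by (simp del: Affine_in_ec_points)
  ultimately show ?thesis using *(1) that by blast
qed

text \<open>\<open>8\<close> is a zero of \<open>dbl_cube\<close>, so the double has abscissa 0 and
  is killed by 3.\<close>

lemma pow6_if_cube_8:
  assumes P: "Affine x y \<in> ec_points 0 a" and x: "x ^ 3 = 8 * a"
  shows "Affine x y [^]\<^bsub>E\<^esub> (6 :: nat) = Infinity"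
proof -
  have t: "x ^ 3 = of_rat 8 * a" using x by simp
  obtain x' y' where *: "ec_add 0 (Affine x y) (Affine x y) = Affine x' y'"
    "Affine x' y' \<in> ec_points 0 a" "x' ^ 3 = of_rat (dbl_cube 8) * a"
    using doubling_cube[OF P t] by auto
  then have "x' = 0" by (simp add: dbl_cube_def)
  then have "(Affine x y [^]\<^bsub>E\<^esub> (2 :: nat)) [^]\<^bsub>E\<^esub> (3 :: nat) = Infinity"
    using pow3_eq_Infinity_iff[OF *(2)] * pow2[OF P] by simp
  then show ?thesis using pow_pow[OF P, of 2 3] by simp
qed

text \<open>Heights of points are read from \<open>t\<close>, which \<open>x\<close> determines
  because \<open>a \<noteq> 0\<close>. Excluding \<open>-1\<close> keeps the doubles affine.\<close>

lemma no_torsion_if_increasing: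
  fixes V :: "int \<Rightarrow> rat \<Rightarrow> bool"
  assumes step: "\<And>e t. V e t \<Longrightarrow> t \<noteq> -1 \<and> (\<exists>f>e. V f (dbl_cube t))"
    and uniq: "\<And>e f t. V e t \<Longrightarrow> V f t \<Longrightarrow> e = f"
    and P: "Affine x y \<in> ec_points 0 a" "x ^ 3 = of_rat t * a" "V e t"
    and n: "n > 0" "Affine x y [^]\<^bsub>E\<^esub> (n :: nat) = Infinity"
  shows False
proof -
  define R where "R e P \<longleftrightarrow> (\<exists>x y t. P = Affine x y \<and> x ^ 3 = of_rat t * a \<and> V e t)" for e P
  show False
  proof (rule E.infinite_order_if_increasing[of R])
    fix e P assume "P \<in> carrier E" "R e P"
    then obtain x y t where xy: "P = Affine x y" "x ^ 3 = of_rat t * a" "V e t"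
      "Affine x y \<in> ec_points 0 a"
      unfolding R_def by (metis ec_group_simps(1))
    with step[OF xy(3)] obtain f x' y' where "f > e" "V f (dbl_cube t)"
      "ec_add 0 P P = Affine x' y'" "x' ^ 3 = of_rat (dbl_cube t) * a"
      using doubling_cube[OF xy(4,2)] by metis
    then show "\<exists>f>e. R f (P \<otimes>\<^bsub>E\<^esub> P)" unfolding R_def by auto
  next
    fix e f P assume "R e P" "R f P"
    then show "e = f" unfolding R_def using uniq a_nonzero by auto
  next
    show "R e (Affine x y)" unfolding R_def using P by blast
  qed (use P n in simp_all)
qed

text \<open>Let \<open>e\<close> be the valuation of \<open>t\<close>. Doubling lowers
  \<open>e < 0\<close> by 6 and raises \<open>e \<ge> 4\<close> by 3. One doubling takes
  \<open>e = 0\<close> and \<open>e = 1\<close> to the first range and \<open>e = 3\<close> to the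
  second, unless \<open>t\<close> is \<open>-1\<close> or \<open>8\<close>. The value
  \<open>e = 2\<close> reproduces itself, and there the valuation of \<open>t + 4\<close>
  grows.\<close>

lemma torsion_rational_cube:
  assumes P: "Affine x y \<in> ec_points 0 a" and t: "x ^ 3 = of_rat t * a"
    and n: "n > 0" "Affine x y [^]\<^bsub>E\<^esub> (n :: nat) = Infinity"
  shows "t = 0 \<or> t = -1 \<or> t = 8 \<or> t = -4"
proof -
  have double: "\<exists>x' y'. Affine x' y' \<in> ec_points 0 a \<and> x' ^ 3 = of_rat (dbl_cube t) * a \<and>
      Affine x' y' [^]\<^bsub>E\<^esub> n = Infinity" if "t \<noteq> -1"
    using doubling_cube[OF P t that] torsion_mult[OF P n(2), of 2] pow2[OF P] by metis
  have neg: False if "Affine x y \<in> ec_points 0 a" "x ^ 3 = of_rat t * a"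
    "Affine x y [^]\<^bsub>E\<^esub> n = Infinity" "val2 t e" "e < 0" for x y t e
  proof (rule no_torsion_if_increasing[OF _ _ that(1,2) _ n(1) that(3)])
    \<comment> \<open>The height is minus the valuation, so that a fall becomes a rise. The bound on
      \<open>e\<close> is part of the predicate to make it pass on to the double.\<close>
    fix e t assume "e > 0 \<and> val2 t (- e)"
    then show "t \<noteq> - 1 \<and> (\<exists>f>e. f > 0 \<and> val2 (dbl_cube t) (- f))"
      using dbl_cube_neg[of t "- e"] val2_plus_1_neg[of t "- e"] val2_nonzero[of "t + 1" "- e"]
      by (intro conjI exI[of _ "e + 6"]) auto
  next
    fix e f t assume "e > 0 \<and> val2 t (- e)" "f > 0 \<and> val2 t (- f)"
    then show "e = f" using val2_unique[of t "- e" "- f"] by simp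
  next
    show "- e > 0 \<and> val2 t (- (- e))" using that(4,5) by simp
  qed
  have pos: False if "Affine x y \<in> ec_points 0 a" "x ^ 3 = of_rat t * a"
    "Affine x y [^]\<^bsub>E\<^esub> n = Infinity" "val2 t e" "e \<ge> 4" for x y t e
  proof (rule no_torsion_if_increasing[OF _ _ that(1,2) _ n(1) that(3)])
    fix e t assume "e \<ge> 4 \<and> val2 t e"
    then show "t \<noteq> - 1 \<and> (\<exists>f>e. f \<ge> 4 \<and> val2 (dbl_cube t) f)"
      using dbl_cube_ge4[of t e] val2_plus_1_pos[of t e] val2_nonzero[of "t + 1" 0]
      by (intro conjI exI[of _ "e + 3"]) auto
  next
    fix e f t assume "e \<ge> 4 \<and> val2 t e" "f \<ge> 4 \<and> val2 t f"
    then show "e = f" using val2_unique[of t e f] by simp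
  next
    show "e \<ge> 4 \<and> val2 t e" using that(4,5) by simp
  qed
  have two: False if "val2 t 2" "val2 (t + 4) g" for g
  proof (rule no_torsion_if_increasing[OF _ _ P t _ n])
    fix e t assume "val2 t 2 \<and> val2 (t + 4) e"
    then show "t \<noteq> - 1 \<and> (\<exists>f>e. val2 (dbl_cube t) 2 \<and> val2 (dbl_cube t + 4) f)"
      using dbl_cube_2[of t e] val2_plus_1_pos[of t 2] val2_nonzero[of "t + 1" 0]
      by (intro conjI exI[of _ "e + 1"]) auto
  next
    fix e f t assume "val2 t 2 \<and> val2 (t + 4) e" "val2 t 2 \<and> val2 (t + 4) f"
    then show "e = f" using val2_unique[of "t + 4" e f] by simp
  next
    show "val2 t 2 \<and> val2 (t + 4) g" using that by simp
  qed
  show ?thesis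
  proof (rule ccontr)
    assume *: "\<not> ?thesis"
    then obtain e where e: "val2 t e" using val2_exists by blast
    from * double obtain x' y' where D: "Affine x' y' \<in> ec_points 0 a"
      "x' ^ 3 = of_rat (dbl_cube t) * a" "Affine x' y' [^]\<^bsub>E\<^esub> n = Infinity"
      by blast
    consider "e < 0" | "e = 0" | "e = 1" | "e = 2" | "e = 3" | "e \<ge> 4" by linarith
    then show False
    proof cases
      case 1
      then show ?thesis using neg[OF P t n(2) e] by simp
    next
      case 2
      then obtain f where "f < 0" "val2 (dbl_cube t) f" using e * dbl_cube_0 by blast
      then show ?thesis using neg[OF D] by blast
    next
      case 3
      then show ?thesis using neg[OF D, of "- 2"] e dbl_cube_1[of t] by simp
    next
      case 4
      have "t + 4 \<noteq> 0" using * by (simp add: eq_neg_iff_add_eq_0)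
      then show ?thesis using two e 4 val2_exists by blast
    next
      case 5
      then obtain f where "f \<ge> 4" "val2 (dbl_cube t) f" using e * dbl_cube_3 by blast
      then show ?thesis using pos[OF D] by blast
    next
      case 6
      then show ?thesis using pos[OF P t n(2) e] by simp
    qed
  qed
qed

lemma torsion_rational_cube_pow6:
  assumes P: "Affine x y \<in> ec_points 0 a" and t: "x ^ 3 = of_rat t * a"
    and n: "n > 0" "Affine x y [^]\<^bsub>E\<^esub> (n :: nat) = Infinity"
  shows "Affine x y [^]\<^bsub>E\<^esub> (6 :: nat) = Infinity"
proof -
  let ?P = "Affine x y"
  consider "t = 0" | "t = -1" | "t = 8" | "t = -4"
    using torsion_rational_cube[OF assms] by blast
  then show ?thesis
  proof cases
    case 1
    then show ?thesis
      using pow_pow[OF P, of 3 2] pow3_eq_Infinity_iff[OF P] t pow_Infinity by simp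
  next
    case 2
    then have "y = 0" using P t by simp
    then show ?thesis
      using pow_pow[OF P, of 2 3] pow2_eq_Infinity_iff[OF P] pow_Infinity by simp
  next
    case 3
    then show ?thesis using pow6_if_cube_8[OF P] t by simp
  next
    case 4
    then have "x ^ 3 + 4 * a = 0" using t by (simp add: of_rat_minus)
    then show ?thesis
      using pow_pow[OF P, of 3 2] pow3_eq_Infinity_iff[OF P] pow_Infinity by simp
  qed
qed

end

section \<open>Conjugation in quadratic fields\<close>

text \<open>Otherwise \<open>x\<close>, \<open>r\<close>, \<open>1\<close> would be independent and
  extend to a basis, which has only two elements.\<close>

lemma quadratic_field_span:
  fixes r x :: "'k :: field_char_0"
  assumes K: "quadratic_field TYPE('k)" and r: "r \<notin> \<rat>"
  obtains p q where "x = of_rat p + of_rat q * r"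
proof -
  interpret vector_space "\<lambda>(q :: rat) (x :: 'k). of_rat q * x"
    by (rule vector_space_of_rat)
  have "y \<in> span {r, 1} \<longleftrightarrow> (\<exists>q p. y - of_rat q * r - of_rat p = 0)"
    "y \<in> span {1} \<longleftrightarrow> (\<exists>p. y - of_rat p = 0)" for y
    by (simp_all add: span_breakdown_eq)
  then have span: "y \<in> span {r, 1} \<longleftrightarrow> (\<exists>q p. y = of_rat p + of_rat q * r)"
    "y \<in> span {1} \<longleftrightarrow> y \<in> \<rat>" for y
    by (auto simp: diff_eq_eq Rats_def)
  show ?thesis
  proof (cases "x \<in> span {r, 1}")
    case False
    have "independent {x, r, 1}" "card {x, r, 1} = 3"
      using False r span_base[of _ "{r, 1}"] span(2)[of r]
      by (auto simp: independent_insert card_insert_if)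
    define B where "B = extend_basis {x, r, 1}"
    have "card B = dim (UNIV :: 'k set)"
      using \<open>independent {x, r, 1}\<close> dim_eq_card[of B UNIV] span_UNIV
        independent_extend_basis span_extend_basis unfolding B_def by metis
    then have "card B = 2" using K unfolding quadratic_field_def by simp
    moreover have "{x, r, 1} \<subseteq> B"
      unfolding B_def by (rule extend_basis_superset) fact
    \<comment> \<open>\<open>card\<close> of an infinite set is 0, so \<open>card B = 2\<close> also
      yields that \<open>B\<close> is finite.\<close>
    ultimately have "card {x, r, 1} \<le> 2"
      using card_mono card.infinite by (metis zero_neq_numeral)
    with \<open>card {x, r, 1} = 3\<close> show ?thesis by simp
  qed (use span(1) that in blast)
qed

lemma quadratic_field_irrational:
  assumes K: "quadratic_field TYPE('k :: field_char_0)"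
  obtains r :: "'k :: field_char_0" where "r \<notin> \<rat>"
proof -
  interpret vector_space "\<lambda>(q :: rat) (x :: 'k). of_rat q * x"
    by (rule vector_space_of_rat)
  have "\<not> (UNIV :: 'k set) \<subseteq> \<rat>"
  proof
    assume "(UNIV :: 'k set) \<subseteq> \<rat>"
    then have "y \<in> span {1}" for y :: 'k
      by (auto simp add: span_breakdown_eq Rats_def)
    then have "card {1 :: 'k} = dim (UNIV :: 'k set)"
      by (intro basis_card_eq_dim) auto
    with K show False unfolding quadratic_field_def by simp
  qed
  then show ?thesis using that by blast
qed

lemma quadratic_field_sqrt:
  assumes K: "quadratic_field TYPE('k :: field_char_0)"
  obtains s :: "'k :: field_char_0" and d where "s \<notin> \<rat>" "s ^ 2 = of_rat d"
proof -
  obtain r :: 'k where r: "r \<notin> \<rat>" using quadratic_field_irrational[OF K] .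
  obtain p q where pq: "r ^ 2 = of_rat p + of_rat q * r"
    using quadratic_field_span[OF K r] .
  \<comment> \<open>Completing the square in \<open>r ^ 2 = p + q * r\<close>.\<close>
  let ?s = "r - of_rat (q / 2)"
  have "?s \<notin> \<rat>" using r Rats_of_rat Rats_add[of ?s "of_rat (q / 2)"] by auto
  moreover have "?s ^ 2 = of_rat (p + q ^ 2 / 4)"
    using pq by (simp add: of_rat_add of_rat_divide of_rat_power power2_diff field_simps)
       (simp add: power2_eq_square of_rat_mult algebra_simps)
  ultimately show ?thesis by (rule that)
qed

locale quadratic_field_conj =
  fixes \<sigma> :: "'k :: field_char_0 \<Rightarrow> 'k"
  assumes add: "\<sigma> (x + y) = \<sigma> x + \<sigma> y" and mult: "\<sigma> (x * y) = \<sigma> x * \<sigma> y"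
    and of_rat: "\<sigma> (of_rat q) = of_rat q" and invol: "\<sigma> (\<sigma> x) = x"
    and fixed: "\<sigma> x = x \<Longrightarrow> x \<in> \<rat>"

lemma irrational_rep_unique:
  fixes s :: "'k :: field_char_0"
  assumes "s \<notin> \<rat>" "of_rat p + of_rat q * s = of_rat p' + of_rat q' * s"
  shows "p = p' \<and> q = q'"
proof -
  have *: "of_rat (q - q') * s = of_rat (p' - p)"
    using assms(2) by (simp add: of_rat_diff algebra_simps)
  have "q = q'"
  proof (rule ccontr)
    assume "q \<noteq> q'"
    then have "s = of_rat ((p' - p) / (q - q'))"
      using * by (simp add: of_rat_divide field_simps)
    with assms(1) show False by simp
  qed
  then show ?thesis using assms(2) by simp
qed

lemma quadratic_field_conj_exists:
  assumes K: "quadratic_field TYPE('k :: field_char_0)"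
  obtains \<sigma> :: "'k :: field_char_0 \<Rightarrow> 'k" where "quadratic_field_conj \<sigma>"
proof -
  obtain s :: 'k and d where s: "s \<notin> \<rat>" "s ^ 2 = of_rat d"
    using quadratic_field_sqrt[OF K] .
  have "\<exists>p q. x = of_rat p + of_rat q * s" for x
    using quadratic_field_span[OF K s(1)] by metis
  then obtain p q where pq: "x = of_rat (p x) + of_rat (q x) * s" for x by metis
  define \<sigma> where "\<sigma> x = of_rat (p x) - of_rat (q x) * s" for x
  \<comment> \<open>The coordinates \<open>p\<close> and \<open>q\<close> come from choice; their
    uniqueness allows computing with any representation.\<close>
  have \<sigma>: "\<sigma> (of_rat u + of_rat v * s) = of_rat u - of_rat v * s" for u v
    using irrational_rep_unique[OF s(1) pq[of "of_rat u + of_rat v * s"]] unfolding \<sigma>_def by simp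
  have "quadratic_field_conj \<sigma>"
  proof
    fix x y :: 'k
    obtain u v u' v' where xy: "x = of_rat u + of_rat v * s" "y = of_rat u' + of_rat v' * s"
      using pq by blast
    show "\<sigma> (x + y) = \<sigma> x + \<sigma> y"
    proof -
      have "x + y = of_rat (u + u') + of_rat (v + v') * s"
        unfolding xy by (simp add: of_rat_add algebra_simps)
      then have "\<sigma> (x + y) = of_rat (u + u') - of_rat (v + v') * s"
        by (simp only: \<sigma>)
      then show ?thesis unfolding xy \<sigma> by (simp add: of_rat_add algebra_simps)
    qed
    have "x * y = of_rat (u * u' + v * v' * d) + of_rat (u * v' + v * u') * s"
      unfolding xy using s(2) by (simp add: of_rat_add of_rat_mult algebra_simps power2_eq_square)
    then have "\<sigma> (x * y) = of_rat (u * u' + v * v' * d) - of_rat (u * v' + v * u') * s"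
      by (simp only: \<sigma>)
    then show "\<sigma> (x * y) = \<sigma> x * \<sigma> y"
      unfolding xy \<sigma> using s(2) by (simp add: of_rat_add of_rat_mult algebra_simps power2_eq_square)
    show "\<sigma> (\<sigma> x) = x"
      using \<sigma>[of u "- v"] \<sigma>[of u v] unfolding xy by (simp add: of_rat_minus)
    show "x \<in> \<rat>" if "\<sigma> x = x"
    proof -
      have "of_rat u + of_rat v * s = of_rat u + of_rat (- v) * s"
        using that unfolding xy \<sigma> by (simp add: of_rat_minus)
      then have "v = 0" using irrational_rep_unique[OF s(1)] by force
      then show ?thesis unfolding xy by simp
    qed
  next
    fix u show "\<sigma> (of_rat u) = of_rat u" using \<sigma>[of u 0] by simp
  qed
  then show ?thesis by (rule that)
qed

section \<open>Conjugation of field elements and of points\<close>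

context quadratic_field_conj
begin

lemma zero: "\<sigma> 0 = 0" and one: "\<sigma> 1 = 1"
  using of_rat[of 0] of_rat[of 1] by simp_all

lemma numeral: "\<sigma> (numeral n) = numeral n"
  using of_rat[of "numeral n"] by simp

lemma eq_iff: "\<sigma> x = \<sigma> y \<longleftrightarrow> x = y"
  using invol by metis

lemma minus: "\<sigma> (- x) = - \<sigma> x"
  using add[of x "- x"] zero by (simp add: eq_neg_iff_add_eq_0 add.commute)

lemma diff: "\<sigma> (x - y) = \<sigma> x - \<sigma> y"
  using add[of x "- y"] minus by simp

lemma power: "\<sigma> (x ^ n) = \<sigma> x ^ n"
  by (induction n) (simp_all add: one mult)

text \<open>At \<open>y = 0\<close> both quotients have the default value 0, so
  \<open>map_point_ec_add\<close> can rewrite without looking at denominators.\<close>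

lemma divide: "\<sigma> (x / y) = \<sigma> x / \<sigma> y"
proof (cases "y = 0")
  case False
  then have "\<sigma> x = \<sigma> (x / y) * \<sigma> y" by (simp flip: mult)
  moreover have "\<sigma> y \<noteq> 0" using False eq_iff[of y 0] zero by simp
  ultimately show ?thesis by (simp add: field_simps)
qed (simp add: zero)

text \<open>The law consists of field operations and equality tests; conjugation respects the former
  and, being injective, the latter.\<close>

lemma map_point_ec_add:
  assumes "\<sigma> A = A"
  shows "map_point \<sigma> (ec_add A P Q) = ec_add A (map_point \<sigma> P) (map_point \<sigma> Q)"
proof (cases P)
  case P: (Affine x1 y1)
  show ?thesis
  proof (cases Q)
    case Q: (Affine x2 y2)
    have "\<sigma> y1 = - \<sigma> y2 \<longleftrightarrow> y1 = - y2" using eq_iff minus by metis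
    then show ?thesis
      by (simp add: P Q Let_def assms eq_iff add mult diff minus divide power numeral)
  qed (simp add: P)
qed simp

lemma map_point_closed:
  assumes "\<sigma> A = A" "\<sigma> B = B" "P \<in> ec_points A B"
  shows "map_point \<sigma> P \<in> ec_points A B"
proof (cases P)
  case (Affine x y)
  with assms(3) have "\<sigma> (y ^ 2) = \<sigma> (x ^ 3 + A * x + B)" by simp
  with Affine assms(1,2) show ?thesis by (simp add: add mult power)
qed simp

lemma map_point_ec_neg: "map_point \<sigma> (ec_neg P) = ec_neg (map_point \<sigma> P)"
  by (cases P) (simp_all add: minus)

lemma map_point_pow:
  assumes "\<sigma> A = A"
  shows "map_point \<sigma> (P [^]\<^bsub>ec_group A B\<^esub> (n :: nat)) = map_point \<sigma> P [^]\<^bsub>ec_group A B\<^esub> n"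
  by (induction n) (simp_all add: nat_pow_def map_point_ec_add[OF assms])

lemma map_point_invol: "map_point \<sigma> (map_point \<sigma> P) = P"
  by (cases P) (simp_all add: invol)

end

text \<open>Conjugation exchanges \<open>P\<close> and \<open>P'\<close>, hence fixes their sum
  \<open>Q\<close> and negates their difference \<open>R\<close>; either way the abscissa is fixed,
  thus rational. Both are killed by 6, and so is \<open>Q + R = 2 P\<close>.\<close>

lemma (in mordell_curve) torsion_quadratic_field_pow12:
  assumes K: "quadratic_field TYPE('k)" and a: "a \<in> \<rat>"
    and P: "P \<in> ec_points 0 a" and n: "n > 0" "P [^]\<^bsub>E\<^esub> (n :: nat) = Infinity"
  shows "P [^]\<^bsub>E\<^esub> (12 :: nat) = Infinity"
proof -
  obtain \<sigma> :: "'k \<Rightarrow> 'k" where "quadratic_field_conj \<sigma>"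
    using quadratic_field_conj_exists[OF K] .
  then interpret quadratic_field_conj \<sigma> .
  have fix_a: "\<sigma> 0 = 0" "\<sigma> a = a"
    using a of_rat zero by (auto elim: Rats_cases)
  define P' where "P' = map_point \<sigma> P"
  have P': "P' \<in> ec_points 0 a"
    unfolding P'_def by (rule map_point_closed[OF fix_a P])
  have n': "P' [^]\<^bsub>E\<^esub> n = Infinity"
    unfolding P'_def using map_point_pow[OF fix_a(1), of a P n] n by simp
  have pow6: "S [^]\<^bsub>E\<^esub> (6 :: nat) = Infinity"
    if S: "S \<in> ec_points 0 a" "S [^]\<^bsub>E\<^esub> n = Infinity"
      "map_point \<sigma> S = S \<or> map_point \<sigma> S = ec_neg S" for S
  proof (cases S)
    case Infinity
    then show ?thesis using E.nat_pow_one[of 6] by simp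
  next
    case (Affine x y)
    then have "\<sigma> x = x" using S(3) by auto
    then have "x ^ 3 / a \<in> \<rat>" using fixed a by simp
    then obtain t where "x ^ 3 / a = of_rat t" by (auto elim: Rats_cases)
    then have "x ^ 3 = of_rat t * a" using a_nonzero by (simp add: field_simps)
    then show ?thesis using torsion_rational_cube_pow6 S n(1) Affine by metis
  qed
  define Q where "Q = ec_add 0 P P'"
  define R where "R = ec_add 0 P (ec_neg P')"
  have Q: "Q \<in> ec_points 0 a" and R: "R \<in> ec_points 0 a"
    unfolding Q_def R_def using P P' by (intro ec_add_closed; simp)+
  have neg: "ec_neg P' [^]\<^bsub>E\<^esub> n = Infinity"
    using E.inv_one E.nat_pow_inv[of P' n] n' P' by (simp add: inv_E)
  have "Q [^]\<^bsub>E\<^esub> (6 :: nat) = Infinity"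
  proof (rule pow6[OF Q])
    show "Q [^]\<^bsub>E\<^esub> n = Infinity"
      unfolding Q_def using E.pow_mult_distrib[of P P' n] E.m_comm[of P P'] P P' n n' by simp
    have "map_point \<sigma> Q = Q"
      unfolding Q_def map_point_ec_add[OF fix_a(1)]
      unfolding P'_def map_point_invol using ec_add_commute P P' P'_def by blast
    then show "map_point \<sigma> Q = Q \<or> map_point \<sigma> Q = ec_neg Q" ..
  qed
  moreover have "R [^]\<^bsub>E\<^esub> (6 :: nat) = Infinity"
  proof (rule pow6[OF R])
    show "R [^]\<^bsub>E\<^esub> n = Infinity"
      unfolding R_def using E.pow_mult_distrib[of P "ec_neg P'" n] E.m_comm[of P "ec_neg P'"] P P' n neg
      by simp
    have "map_point \<sigma> R = ec_add 0 P' (ec_neg P)"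
      unfolding R_def map_point_ec_add[OF fix_a(1)] map_point_ec_neg
      unfolding P'_def map_point_invol ..
    also have "\<dots> = ec_neg R"
      unfolding R_def using E.inv_mult_group[of P "ec_neg P'"] P P' R R_def by (simp add: inv_E)
    finally show "map_point \<sigma> R = R \<or> map_point \<sigma> R = ec_neg R" ..
  qed
  moreover have "ec_add 0 Q R = P [^]\<^bsub>E\<^esub> (2 :: nat)"
  proof -
    have "ec_add 0 Q R = ec_add 0 P (ec_add 0 P' (ec_add 0 (ec_neg P') P))"
      unfolding Q_def R_def
      using P P' ec_add_closed[of "ec_neg P'" 0 a P] ec_add_assoc[of P P' "ec_add 0 (ec_neg P') P"]
      by (simp add: ec_add_commute[OF P, of "ec_neg P'"])
    also have "\<dots> = ec_add 0 P P"
      using ec_neg_add_cancel[of "ec_neg P'" P] P P' by simp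
    finally show ?thesis using pow2 P by simp
  qed
  ultimately have "(P [^]\<^bsub>E\<^esub> (2 :: nat)) [^]\<^bsub>E\<^esub> (6 :: nat) = Infinity"
    using E.pow_mult_distrib[of Q R 6] E.m_comm[of Q R] Q R by simp
  then show ?thesis using E.nat_pow_pow[of P 2 6] P by simp
qed

section \<open>Cubes and square roots in quadratic fields\<close>

lemma rat_power_eq_of_intE:
  fixes q :: rat
  assumes "q ^ n = of_int m" "n > 0"
  obtains k where "q = of_int k"
proof -
  obtain u v where uv: "quotient_of q = (u, v)" by fastforce
  then have v: "v > 0" "coprime u v" and q: "q = of_int u / of_int v"
    using quotient_of_denom_pos quotient_of_coprime quotient_of_div by auto
  have "of_int (u ^ n) = (of_int (m * v ^ n) :: rat)"
    using assms(1) v(1) unfolding q by (simp add: power_divide field_simps)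
  then have "u ^ n = m * v ^ n" by (simp only: of_int_eq_iff)
  then have "v dvd u ^ n" using assms(2) by (simp add: dvd_power)
  moreover have "coprime (u ^ n) v" using v(2) by simp
  ultimately have "v = 1" using v(1) by (metis coprime_common_divisor dvd_refl zdvd1_eq abs_of_pos)
  with q that show ?thesis by simp
qed

lemma rat_cube_neq_minus_4: "(q :: rat) ^ 3 \<noteq> - 4"
proof
  assume *: "q ^ 3 = - 4"
  then have "q ^ 3 = of_int (- 4)" by simp
  then obtain k where k: "q = of_int k" by (rule rat_power_eq_of_intE) simp
  with * have "of_int (k ^ 3) = (of_int (- 4) :: rat)" by simp
  then have k3: "k ^ 3 = - 4" by (simp only: of_int_eq_iff)
  show False
  proof (cases "k \<ge> - 1")
    case True
    then have "(- 1) ^ 3 \<le> k ^ 3" by (intro power_mono_odd) simp_all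
    with k3 show False by simp
  next
    case False
    then have "k ^ 3 \<le> (- 2) ^ 3" by (intro power_mono_odd) simp_all
    with k3 show False by simp
  qed
qed

lemma rat_square_neq_3: "(q :: rat) ^ 2 \<noteq> 3"
proof
  assume *: "q ^ 2 = 3"
  then have "q ^ 2 = of_int 3" by simp
  then obtain k where k: "q = of_int k" by (rule rat_power_eq_of_intE) simp
  with * have "of_int (k ^ 2) = (of_int 3 :: rat)" by simp
  then have k2: "\<bar>k\<bar> ^ 2 = 3" by (simp only: of_int_eq_iff power2_abs)
  show False
  proof (cases "\<bar>k\<bar> \<le> 1")
    case True
    then have "\<bar>k\<bar> ^ 2 \<le> 1 ^ 2" by (intro power_mono) simp_all
    with k2 show False by simp
  next
    case False
    then have "2 ^ 2 \<le> \<bar>k\<bar> ^ 2" by (intro power_mono) simp_all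
    with k2 show False by simp
  qed
qed

text \<open>The square of \<open>c / m\<close> is the integer \<open>m\<close>, so
  \<open>c / m\<close> is itself an integer \<open>b\<close>; then \<open>m = b ^ 2\<close> and
  \<open>c = b * m\<close>.\<close>

lemma square_eq_cube_imp_cube:
  fixes c m :: int
  assumes "c ^ 2 = m ^ 3"
  obtains b where "c = b ^ 3"
proof (cases "m = 0")
  case True
  with assms that[of 0] show ?thesis by simp
next
  case False
  let ?r = "of_int c / of_int m :: rat"
  have "of_int (c ^ 2) = (of_int (m ^ 3) :: rat)" using assms by simp
  then have "?r ^ 2 = of_int m"
    using False by (simp add: power_divide field_simps power2_eq_square power3_eq_cube)
  then obtain b where b: "?r = of_int b" by (rule rat_power_eq_of_intE) simp
  with \<open>?r ^ 2 = of_int m\<close> have "of_int (b ^ 2) = (of_int m :: rat)" by simp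
  then have "m = b ^ 2" by (simp only: of_int_eq_iff)
  moreover have "of_int c = (of_int (b * m) :: rat)" using b False by (simp add: field_simps)
  then have "c = b * m" by (simp only: of_int_eq_iff)
  ultimately show ?thesis by (intro that[of b]) (simp add: power2_eq_square power3_eq_cube)
qed

lemma sqrt_minus_3_irrational:
  fixes w :: "'k :: field_char_0"
  assumes "w ^ 2 = - 3"
  shows "w \<notin> \<rat>"
proof
  assume "w \<in> \<rat>"
  then obtain q where "w = of_rat q" by (auto elim: Rats_cases)
  with assms have "of_rat (q ^ 2) = (of_rat (- 3) :: 'k)" by (simp add: of_rat_power of_rat_minus)
  then have "q ^ 2 = - 3" by (simp only: of_rat_eq_iff)
  then show False using zero_le_power2[of q] by simp
qed

lemma quadratic_field_rational_cube:
  fixes x :: "'k :: field_char_0"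
  assumes K: "quadratic_field TYPE('k)" and x: "x ^ 3 = of_rat r"
  obtains q where "q ^ 3 = r"
proof -
  obtain s :: 'k and d where s: "s \<notin> \<rat>" "s ^ 2 = of_rat d"
    using quadratic_field_sqrt[OF K] .
  obtain p q where pq: "x = of_rat p + of_rat q * s"
    using quadratic_field_span[OF K s(1)] .
  have "x ^ 3 = of_rat p ^ 3 + 3 * of_rat p * of_rat q ^ 2 * s ^ 2
      + (3 * of_rat p ^ 2 * of_rat q + of_rat q ^ 3 * s ^ 2) * s"
    unfolding pq by algebra
  also have "\<dots> = of_rat (p ^ 3 + 3 * p * q ^ 2 * d) + of_rat (3 * p ^ 2 * q + q ^ 3 * d) * s"
    unfolding s(2) by (simp add: of_rat_add of_rat_mult of_rat_power)
  finally have "of_rat (p ^ 3 + 3 * p * q ^ 2 * d) + of_rat (3 * p ^ 2 * q + q ^ 3 * d) * s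
      = of_rat r + of_rat 0 * s"
    using x by simp
  then have *: "p ^ 3 + 3 * p * q ^ 2 * d = r" "3 * p ^ 2 * q + q ^ 3 * d = 0"
    using irrational_rep_unique[OF s(1)] by blast+
  show ?thesis
  proof (cases "q = 0")
    case True
    with * show ?thesis by (intro that[of p]) simp
  next
    case False
    have "q * (3 * p ^ 2 + q ^ 2 * d) = 0" using *(2) by algebra
    with False have "3 * p ^ 2 + q ^ 2 * d = 0" by simp
    \<comment> \<open>If \<open>x\<close> is irrational, it and its conjugate are two of the three
      cube roots of \<open>r\<close>. These sum to 0, so the third is
      \<open>- 2 * p\<close>.\<close>
    then have "(- 2 * p) ^ 3 = r" using *(1) by algebra
    then show ?thesis by (rule that)
  qed
qed

text \<open>The equation says \<open>w ^ 2 = - 9 + 6 * r\<close> with \<open>r ^ 2 = 3\<close>, for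
  either choice of root. The number \<open>- 9 + 6 * sqrt 3\<close> is positive, so its sign yields
  nothing; the rational part of \<open>w ^ 2\<close> does.\<close>

lemma quadratic_field_not_square_minus_9_6_sqrt_3:
  fixes w :: "'k :: field_char_0"
  assumes K: "quadratic_field TYPE('k)"
  shows "(w ^ 2 + 9) ^ 2 \<noteq> 108"
proof
  assume *: "(w ^ 2 + 9) ^ 2 = 108"
  define r where "r = (w ^ 2 + 9) / 6"
  have r: "r ^ 2 = 3" unfolding r_def using * by (simp add: power_divide)
  have "r \<notin> \<rat>"
  proof
    assume "r \<in> \<rat>"
    then obtain q where "r = of_rat q" by (auto elim: Rats_cases)
    with r have "of_rat (q ^ 2) = (of_rat 3 :: 'k)" by (simp add: of_rat_power)
    then show False using rat_square_neq_3 by (simp only: of_rat_eq_iff)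
  qed
  obtain p q where w: "w = of_rat p + of_rat q * r"
    using quadratic_field_span[OF K \<open>r \<notin> \<rat>\<close>] .
  have "of_rat (p ^ 2 + 3 * q ^ 2) + of_rat (2 * p * q) * r
      = of_rat p ^ 2 + 3 * of_rat q ^ 2 + 2 * of_rat p * of_rat q * r"
    by (simp add: of_rat_add of_rat_mult of_rat_power)
  also have "\<dots> = w ^ 2" unfolding w r[symmetric] by algebra
  also have "\<dots> = of_rat (- 9) + of_rat 6 * r"
    unfolding r_def by (simp add: of_rat_minus field_simps)
  finally have "p ^ 2 + 3 * q ^ 2 = - 9"
    using irrational_rep_unique[OF \<open>r \<notin> \<rat>\<close>] by blast
  then show False using zero_le_power2[of p] zero_le_power2[of q] by linarith
qed

section \<open>The field generated by a square root of -3\<close>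

lemma is_subfield_of_rat:
  fixes S :: "'a :: field_char_0 set"
  assumes "is_subfield S"
  shows "of_rat q \<in> S"
proof -
  have nat: "of_nat n \<in> S" for n
    using assms unfolding is_subfield_def by (induction n) auto
  have int: "of_int m \<in> S" for m
  proof (cases m rule: int_cases2)
    case (nonneg n)
    with nat show ?thesis by simp
  next
    case (nonpos n)
    with nat assms show ?thesis unfolding is_subfield_def by simp
  qed
  obtain m n where "q = of_int m / of_int n" by (metis quotient_of_div prod.collapse)
  then have "of_rat q = (of_int m :: 'a) / of_int n"
    by (simp add: of_rat_divide)
  then have "of_rat q = (of_int m :: 'a) * inverse (of_int n)"
    by (simp only: divide_inverse)
  then show ?thesis using int assms unfolding is_subfield_def by simp
qed

lemma Q_sqrt_minus_3_eq: "Q_sqrt_minus_3 = {of_rat p + of_rat q * csqrt (- 3) | p q. True}"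
    (is "_ = ?S")
proof
  let ?z = "csqrt (- 3)"
  have z: "?z ^ 2 = - 3" by (rule power2_csqrt)
  show "Q_sqrt_minus_3 \<subseteq> ?S"
    unfolding Q_sqrt_minus_3_def
  proof (rule hull_minimal)
    have "?z = of_rat 0 + of_rat 1 * ?z" by simp
    then show "{?z} \<subseteq> ?S" by blast
    show "is_subfield ?S"
      unfolding is_subfield_def
    proof (intro conjI ballI)
      have "(0 :: complex) = of_rat 0 + of_rat 0 * ?z" "(1 :: complex) = of_rat 1 + of_rat 0 * ?z" by simp_all
      then show "0 \<in> ?S" "1 \<in> ?S" by blast+
    next
      fix x y assume "x \<in> ?S" "y \<in> ?S"
      then obtain p q p' q' where xy: "x = of_rat p + of_rat q * ?z" "y = of_rat p' + of_rat q' * ?z" by blast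
      have "x + y = of_rat (p + p') + of_rat (q + q') * ?z"
        unfolding xy by (simp add: of_rat_add algebra_simps)
      then show "x + y \<in> ?S" by blast
      have "x * y = of_rat p * of_rat p' + of_rat q * of_rat q' * ?z ^ 2
          + (of_rat p * of_rat q' + of_rat q * of_rat p') * ?z"
        unfolding xy by algebra
      also have "\<dots> = of_rat (p * p' - 3 * q * q') + of_rat (p * q' + q * p') * ?z"
        unfolding z by (simp add: of_rat_add of_rat_mult of_rat_diff)
      finally show "x * y \<in> ?S" by blast
    next
      fix x assume "x \<in> ?S"
      then obtain p q where x: "x = of_rat p + of_rat q * ?z" by blast
      have "- x = of_rat (- p) + of_rat (- q) * ?z" unfolding x by (simp add: of_rat_minus)
      then show "- x \<in> ?S" by blast
      show "inverse x \<in> ?S"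
      proof (cases "x = 0")
        case True
        then show ?thesis using \<open>x \<in> ?S\<close> by simp
      next
        case False
        \<comment> \<open>The norm of \<open>x\<close>, which vanishes only for
          \<open>p = q = 0\<close>.\<close>
        define n where "n = p ^ 2 + 3 * q ^ 2"
        have "n \<noteq> 0"
        proof
          assume "n = 0"
          then have "p = 0 \<and> q = 0"
            unfolding n_def using zero_le_power2[of p] zero_le_power2[of q]
            by (auto simp: add_nonneg_eq_0_iff)
          with False x show False by simp
        qed
        have "x * (of_rat p - of_rat q * ?z) = of_rat p ^ 2 - of_rat q ^ 2 * ?z ^ 2"
          unfolding x by algebra
        also have "\<dots> = of_rat n"
          unfolding z n_def by (simp add: of_rat_add of_rat_mult of_rat_power)
        finally have "x * (of_rat (p / n) + of_rat (- q / n) * ?z) = 1"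
          using \<open>n \<noteq> 0\<close> by (simp add: of_rat_divide of_rat_minus field_simps)
        then have "inverse x = of_rat (p / n) + of_rat (- q / n) * ?z"
          by (rule inverse_unique)
        then show ?thesis by blast
      qed
    qed
  qed
next
  let ?z = "csqrt (- 3)"
  show "?S \<subseteq> Q_sqrt_minus_3"
  proof
    fix x assume "x \<in> ?S"
    then obtain p q where x: "x = of_rat p + of_rat q * ?z" by blast
    have "x \<in> T" if "is_subfield T" "{?z} \<subseteq> T" for T
      using that is_subfield_of_rat[OF that(1)] unfolding x is_subfield_def by simp
    then show "x \<in> Q_sqrt_minus_3" unfolding Q_sqrt_minus_3_def hull_def by blast
  qed
qed

lemma is_Q_sqrt_minus_3_iff:
  assumes K: "quadratic_field TYPE('k)"
  shows "is_Q_sqrt_minus_3 TYPE('k :: field_char_0) \<longleftrightarrow> (\<exists>w :: 'k. w ^ 2 = - 3)"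
proof
  let ?z = "csqrt (- 3)"
  assume "is_Q_sqrt_minus_3 TYPE('k)"
  then obtain \<phi> :: "'k \<Rightarrow> complex" where \<phi>: "bij_betw \<phi> UNIV Q_sqrt_minus_3" "\<phi> 1 = 1"
    "\<And>x y. \<phi> (x + y) = \<phi> x + \<phi> y" "\<And>x y. \<phi> (x * y) = \<phi> x * \<phi> y"
    unfolding is_Q_sqrt_minus_3_def by auto
  have "?z \<in> Q_sqrt_minus_3" unfolding Q_sqrt_minus_3_def by (rule hull_inc) simp
  then obtain w where w: "\<phi> w = ?z" using \<phi>(1) unfolding bij_betw_def by force
  \<comment> \<open>The assumptions on \<open>\<phi>\<close> do not mention numerals, hence
    \<open>3\<close> is spelled as a sum of ones.\<close>
  have "\<phi> (w ^ 2 + (1 + 1 + 1)) = \<phi> w * \<phi> w + (1 + 1 + 1)"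
    by (simp only: \<phi> power2_eq_square)
  also have "\<dots> = 0" unfolding w by (simp only: power2_eq_square[symmetric] power2_csqrt) simp
  also have "\<dots> = \<phi> 0" using \<phi>(3)[of 0 0] by simp
  finally have "w ^ 2 + (1 + 1 + 1) = 0"
    using \<phi>(1) unfolding bij_betw_def by (simp add: inj_eq)
  then have "w ^ 2 = - 3" by (simp add: eq_neg_iff_add_eq_0)
  then show "\<exists>w :: 'k. w ^ 2 = - 3" ..
next
  let ?z = "csqrt (- 3)"
  assume "\<exists>w :: 'k. w ^ 2 = - 3"
  then obtain w :: 'k where w: "w ^ 2 = - 3" ..
  have z: "?z ^ 2 = - 3" by (rule power2_csqrt)
  note irr = sqrt_minus_3_irrational[OF w] sqrt_minus_3_irrational[OF z]
  have "\<exists>p q. x = of_rat p + of_rat q * w" for x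
    using quadratic_field_span[OF K irr(1)] by metis
  then obtain p q where pq: "x = of_rat (p x) + of_rat (q x) * w" for x by metis
  define \<phi> where "\<phi> x = of_rat (p x) + of_rat (q x) * ?z" for x
  have \<phi>: "\<phi> (of_rat u + of_rat v * w) = of_rat u + of_rat v * ?z" for u v
    using irrational_rep_unique[OF irr(1) pq[of "of_rat u + of_rat v * w"]] unfolding \<phi>_def by simp
  have "inj \<phi>"
  proof (rule injI)
    fix x y assume "\<phi> x = \<phi> y"
    then have "p x = p y \<and> q x = q y"
      unfolding \<phi>_def by (rule irrational_rep_unique[OF irr(2)])
    then show "x = y" using pq by metis
  qed
  moreover have "range \<phi> = Q_sqrt_minus_3"
    unfolding Q_sqrt_minus_3_eq
  proof (intro equalityI subsetI)
    fix y assume "y \<in> {of_rat p + of_rat q * ?z | p q. True}"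
    then obtain u v where "y = of_rat u + of_rat v * ?z" by blast
    then show "y \<in> range \<phi>" using \<phi>[of u v] by (metis rangeI)
  qed (auto simp: \<phi>_def)
  ultimately have "bij_betw \<phi> UNIV Q_sqrt_minus_3" unfolding bij_betw_def by blast
  moreover have "\<phi> 1 = 1" using \<phi>[of 1 0] by simp
  moreover have "\<phi> (x + y) = \<phi> x + \<phi> y" "\<phi> (x * y) = \<phi> x * \<phi> y" for x y
  proof -
    obtain u v u' v' where xy: "x = of_rat u + of_rat v * w" "y = of_rat u' + of_rat v' * w"
      using pq by blast
    have "x + y = of_rat (u + u') + of_rat (v + v') * w"
      unfolding xy by (simp add: of_rat_add algebra_simps)
    then have "\<phi> (x + y) = of_rat (u + u') + of_rat (v + v') * ?z" by (simp only: \<phi>)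
    then show "\<phi> (x + y) = \<phi> x + \<phi> y" unfolding xy \<phi> by (simp add: of_rat_add algebra_simps)
    have "x * y = of_rat u * of_rat u' + of_rat v * of_rat v' * w ^ 2
        + (of_rat u * of_rat v' + of_rat v * of_rat u') * w"
      unfolding xy by algebra
    also have "\<dots> = of_rat (u * u' - 3 * v * v') + of_rat (u * v' + v * u') * w"
      unfolding w by (simp add: of_rat_add of_rat_mult of_rat_diff)
    finally have "\<phi> (x * y) = of_rat (u * u' - 3 * v * v') + of_rat (u * v' + v * u') * ?z"
      by (simp only: \<phi>)
    also have "\<dots> = of_rat u * of_rat u' + of_rat v * of_rat v' * ?z ^ 2
        + (of_rat u * of_rat v' + of_rat v * of_rat u') * ?z"
      unfolding z by (simp add: of_rat_add of_rat_mult of_rat_diff)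
    also have "\<dots> = \<phi> x * \<phi> y" unfolding xy \<phi> by algebra
    finally show "\<phi> (x * y) = \<phi> x * \<phi> y" .
  qed
  ultimately show "is_Q_sqrt_minus_3 TYPE('k)" unfolding is_Q_sqrt_minus_3_def by blast
qed

section \<open>Determination of the torsion subgroup\<close>

context mordell_curve
begin

lemma torsion_group: "comm_group (torsion_subgroup E)"
  by (rule E.comm_group_torsion_subgroup)

section \<open>Sixth powers\<close>

lemma two_torsion_sixth_power:
  assumes a: "a = \<beta> ^ 6" and P: "Affine x y \<in> ec_points 0 a" "y = 0" and "x \<noteq> - (\<beta> ^ 2)"
  shows "((2 * x - \<beta> ^ 2) / \<beta> ^ 2) ^ 2 = - 3"
proof -
  have "\<beta> \<noteq> 0" using a_nonzero a by auto
  \<comment> \<open>The quadratic factor of \<open>x ^ 3 + \<beta> ^ 6\<close> has discriminant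
    \<open>- 3 * \<beta> ^ 4\<close>.\<close>
  have "(x + \<beta> ^ 2) * (x ^ 2 - \<beta> ^ 2 * x + \<beta> ^ 4) = 0"
    using P a by simp algebra
  then have "x ^ 2 - \<beta> ^ 2 * x + \<beta> ^ 4 = 0"
    using assms(4) by (simp add: eq_neg_iff_add_eq_0)
  then have "(2 * x - \<beta> ^ 2) ^ 2 = - 3 * \<beta> ^ 4" by algebra
  then show ?thesis using \<open>\<beta> \<noteq> 0\<close> by (simp add: power_divide flip: power_mult)
qed

lemma order_4_sixth_power:
  assumes K: "quadratic_field TYPE('k)" and a: "a = \<beta> ^ 6"
    and P: "P \<in> ec_points 0 a" "P [^]\<^bsub>E\<^esub> (4 :: nat) = Infinity"
  shows "P [^]\<^bsub>E\<^esub> (2 :: nat) = Infinity"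
proof (rule ccontr)
  assume neq: "P [^]\<^bsub>E\<^esub> (2 :: nat) \<noteq> Infinity"
  have "\<beta> \<noteq> 0" using a_nonzero a by auto
  obtain x y where xy: "P = Affine x y" using neq pow_Infinity by (cases P) auto
  with neq have "y \<noteq> 0" using pow2_eq_Infinity_iff P(1) by blast
  then obtain e f where D: "ec_add 0 P P = Affine e f" "4 * y ^ 2 * e = x * (x ^ 3 - 8 * a)"
    using doubling P(1) xy by metis
  have mem: "Affine e f \<in> ec_points 0 a" using D(1) P(1) ec_add_closed by metis
  have "Affine e f [^]\<^bsub>E\<^esub> (2 :: nat) = Infinity"
    using pow_pow[OF P(1), of 2 2] P(2) pow2[OF P(1)] D(1) by simp
  then have "f = 0" using pow2_eq_Infinity_iff mem by blast
  then have e: "e ^ 3 = - a" using mem by (simp add: eq_neg_iff_add_eq_0)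
  \<comment> \<open>The ordinate after scaling the curve to \<open>Y ^ 2 = X ^ 3 + 1\<close>, so
    that \<open>w ^ 2 = t + 1\<close>.\<close>
  define w where "w = y / \<beta> ^ 3"
  have y: "y = w * \<beta> ^ 3" unfolding w_def using \<open>\<beta> \<noteq> 0\<close> by simp
  have x: "x ^ 3 = (w ^ 2 - 1) * \<beta> ^ 6"
    using P(1) unfolding xy y a by simp algebra
  have "64 * y ^ 6 * e ^ 3 = x ^ 3 * (x ^ 3 - 8 * a) ^ 3" using D(2) by algebra
  \<comment> \<open>With \<open>z = w ^ 2\<close> the equation reads
    \<open>(z - 1) * (z - 9) ^ 3 + 64 * z ^ 3 = 0\<close>, and its left side is
    \<open>(z ^ 2 + 18 * z - 27) ^ 2\<close>. The square reflects that the halves of a point of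
    order two are pairs of opposite points.\<close>
  then have "((w ^ 2 + 9) ^ 2 - 108) ^ 2 * \<beta> ^ 24 = 0"
    unfolding e x y a by algebra
  then have "(w ^ 2 + 9) ^ 2 = 108" using \<open>\<beta> \<noteq> 0\<close> by simp
  with quadratic_field_not_square_minus_9_6_sqrt_3[OF K] show False by blast
qed

text \<open>A root of the other factor, \<open>x ^ 3 = - 4 * a\<close>, would make \<open>-4\<close>
  a cube in the field, hence in the rationals.\<close>

lemma three_torsion_sixth_power:
  assumes K: "quadratic_field TYPE('k)" and a: "a = \<beta> ^ 6" and \<beta>: "\<beta> \<in> \<rat>"
    and P: "P \<in> ec_points 0 a" "P [^]\<^bsub>E\<^esub> (3 :: nat) = Infinity"
  shows "P \<in> {Infinity, Affine 0 (\<beta> ^ 3), Affine 0 (- (\<beta> ^ 3))}"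
proof (cases P)
  case (Affine x y)
  have "\<beta> \<noteq> 0" using a_nonzero a by auto
  have "x ^ 3 + 4 * a \<noteq> 0"
  proof
    assume "x ^ 3 + 4 * a = 0"
    then have "(x / \<beta> ^ 2) ^ 3 = of_rat (- 4)"
      using a \<open>\<beta> \<noteq> 0\<close> by (simp add: power_divide field_simps eq_neg_iff_add_eq_0 flip: power_mult)
    then show False using quadratic_field_rational_cube[OF K] rat_cube_neq_minus_4 by metis
  qed
  then have "x = 0" using pow3_eq_Infinity_iff P Affine by auto
  then have "y ^ 2 = (\<beta> ^ 3) ^ 2" using P(1) Affine a by simp
  then have "y = \<beta> ^ 3 \<or> y = - (\<beta> ^ 3)" by (simp only: power2_eq_iff)
  with \<open>x = 0\<close> Affine show ?thesis by auto
qed simp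

lemma torsion_sixth_power:
  assumes K: "quadratic_field TYPE('k)" and a: "a = \<beta> ^ 6" and \<beta>: "\<beta> \<in> \<rat>"
    and P: "P \<in> carrier (torsion_subgroup E)"
  shows "P [^]\<^bsub>E\<^esub> (6 :: nat) = Infinity"
proof -
  have P': "P \<in> ec_points 0 a" using P by simp
  have "a \<in> \<rat>" using a \<beta> by simp
  then have "P [^]\<^bsub>E\<^esub> (12 :: nat) = Infinity"
    using torsion_quadratic_field_pow12[OF K] P by auto
  then have "(P [^]\<^bsub>E\<^esub> (3 :: nat)) [^]\<^bsub>E\<^esub> (4 :: nat) = Infinity"
    using pow_pow[OF P', of 3 4] by simp
  then have "(P [^]\<^bsub>E\<^esub> (3 :: nat)) [^]\<^bsub>E\<^esub> (2 :: nat) = Infinity"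
    by (rule order_4_sixth_power[OF K a pow_closed[OF P']])
  then show ?thesis using pow_pow[OF P', of 3 2] by simp
qed

text \<open>From \<open>6 P = 0\<close> follows \<open>P = 3 P + 4 P\<close>, where
  \<open>3 P\<close> is killed by 2 and \<open>4 P\<close> by 3. \<open>X\<close> is a parameter
  because the field decides whether one or three abscissas belong to points of order two.\<close>

lemma torsion_sixth_power_subset:
  assumes K: "quadratic_field TYPE('k)" and a: "a = \<beta> ^ 6" and \<beta>: "\<beta> \<in> \<rat>"
    and X: "\<And>x. Affine x 0 \<in> ec_points 0 a \<Longrightarrow> x \<in> X" and "finite X"
  shows "finite (carrier (torsion_subgroup E))"
    "card (carrier (torsion_subgroup E)) \<le> 3 * (card X + 1)"
proof -
  let ?E2 = "insert Infinity ((\<lambda>x. Affine x 0) ` X)"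
  let ?E3 = "{Infinity, Affine 0 (\<beta> ^ 3), Affine 0 (- (\<beta> ^ 3))}"
  have sub: "carrier (torsion_subgroup E) \<subseteq> (\<lambda>(P, Q). ec_add 0 P Q) ` (?E2 \<times> ?E3)"
  proof
    fix P assume P: "P \<in> carrier (torsion_subgroup E)"
    then have P': "P \<in> ec_points 0 a" by simp
    have 6: "P [^]\<^bsub>E\<^esub> (6 :: nat) = Infinity"
      using torsion_sixth_power[OF K a \<beta> P] .
    define S where "S = P [^]\<^bsub>E\<^esub> (3 :: nat)"
    define T where "T = P [^]\<^bsub>E\<^esub> (4 :: nat)"
    have ST: "S \<in> ec_points 0 a" "T \<in> ec_points 0 a"
      unfolding S_def T_def using pow_closed[OF P'] by auto
    have "S [^]\<^bsub>E\<^esub> (2 :: nat) = Infinity"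
      unfolding S_def using pow_pow[OF P', of 3 2] 6 by simp
    then have "S \<in> ?E2"
      using X pow2_eq_Infinity_iff ST(1) by (cases S) auto
    have "T [^]\<^bsub>E\<^esub> (3 :: nat) = (P [^]\<^bsub>E\<^esub> (6 :: nat)) [^]\<^bsub>E\<^esub> (2 :: nat)"
      unfolding T_def using pow_pow[OF P', of 4 3] pow_pow[OF P', of 6 2] by simp
    then have "T [^]\<^bsub>E\<^esub> (3 :: nat) = Infinity" using 6 pow_Infinity by simp
    then have "T \<in> ?E3" using three_torsion_sixth_power[OF K a \<beta> ST(2)] by blast
    have "ec_add 0 S T = ec_add 0 (P [^]\<^bsub>E\<^esub> (6 :: nat)) (P [^]\<^bsub>E\<^esub> (1 :: nat))"
      unfolding S_def T_def using pow_add[OF P', of 3 4] pow_add[OF P', of 6 1] by simp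
    then have "P = ec_add 0 S T" using 6 P' by simp
    moreover have "(S, T) \<in> ?E2 \<times> ?E3" using \<open>S \<in> ?E2\<close> \<open>T \<in> ?E3\<close> by (rule SigmaI)
    ultimately show "P \<in> (\<lambda>(P, Q). ec_add 0 P Q) ` (?E2 \<times> ?E3)"
      by (intro image_eqI[of _ _ "(S, T)"]) (simp_all only: case_prod_conv)
  qed
  have fin: "finite (?E2 \<times> ?E3)" using \<open>finite X\<close> by simp
  show "finite (carrier (torsion_subgroup E))"
    using sub fin finite_subset by blast
  have "card (carrier (torsion_subgroup E)) \<le> card (?E2 \<times> ?E3)"
    using surj_card_le[OF fin sub] .
  also have "\<dots> = card ?E2 * card ?E3" by (rule card_cartesian_product)
  also have "\<dots> \<le> (card X + 1) * 3"
  proof (rule mult_mono)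
    have "card ?E2 \<le> Suc (card ((\<lambda>x. Affine x 0) ` X))"
      by (rule card_insert_le_m1) simp_all
    also have "\<dots> \<le> card X + 1" using card_image_le[OF \<open>finite X\<close>] by simp
    finally show "card ?E2 \<le> card X + 1" .
    show "card ?E3 \<le> 3" by (simp add: card_insert_if)
  qed simp_all
  finally show "card (carrier (torsion_subgroup E)) \<le> 3 * (card X + 1)" by simp
qed

text \<open>The point with \<open>t = 8\<close>, killed by 6 but neither by 2 nor by 3. Killed by 4
  or 5, it would also be killed by 2 or 1, the complements to 6.\<close>

lemma order_6_point:
  assumes a: "a = \<beta> ^ 6"
  defines "B \<equiv> Affine (2 * \<beta> ^ 2) (3 * \<beta> ^ 3)"
  shows "B \<in> ec_points 0 a" "B [^]\<^bsub>E\<^esub> (6 :: nat) = Infinity"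
    "B [^]\<^bsub>E\<^esub> (i :: nat) = Infinity \<Longrightarrow> i < 6 \<Longrightarrow> i = 0"
proof -
  have "\<beta> \<noteq> 0" using a_nonzero a by auto
  have x: "(2 * \<beta> ^ 2) ^ 3 = 8 * a" unfolding a by algebra
  have "(3 * \<beta> ^ 3) ^ 2 = 8 * a + a" unfolding a by algebra
  then show B: "B \<in> ec_points 0 a" unfolding B_def using x by simp
  show 6: "B [^]\<^bsub>E\<^esub> (6 :: nat) = Infinity"
    using pow6_if_cube_8 B x unfolding B_def by blast
  have 2: "B [^]\<^bsub>E\<^esub> (2 :: nat) \<noteq> Infinity"
    using pow2_eq_Infinity_iff B \<open>\<beta> \<noteq> 0\<close> unfolding B_def by simp
  have 3: "B [^]\<^bsub>E\<^esub> (3 :: nat) \<noteq> Infinity"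
  proof -
    have "2 * \<beta> ^ 2 * (8 * a + 4 * a) \<noteq> 0" using \<open>\<beta> \<noteq> 0\<close> a_nonzero by simp
    then show ?thesis using pow3_eq_Infinity_iff B unfolding B_def x[symmetric] by blast
  qed
  have 1: "B \<noteq> Infinity" unfolding B_def by simp
  show "i = 0" if i: "B [^]\<^bsub>E\<^esub> i = Infinity" "i < 6"
  proof (rule ccontr)
    assume "i \<noteq> 0"
    then consider "i = 1" | "i = 2" | "i = 3" | "i = 4" | "i = 5" using i(2) by linarith
    then show False
    proof cases
      case 1
      then show False using i(1) B \<open>B \<noteq> Infinity\<close> by simp
    next
      case 4
      then show False using pow_add[OF B, of 4 2] i(1) 2 6 by simp
    next
      case 5
      then show False using pow_add[OF B, of 5 1] i(1) 1 6 B by simp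
    qed (use i(1) 2 3 in auto)
  qed
qed

lemma torsion_iso_6:
  assumes K: "quadratic_field TYPE('k)" and a: "a = \<beta> ^ 6" and \<beta>: "\<beta> \<in> \<rat>"
    and w: "\<nexists>w :: 'k. w ^ 2 = - 3"
  shows "torsion_subgroup E \<cong> integer_mod_group 6"
proof -
  interpret T: comm_group "torsion_subgroup E" by (rule torsion_group)
  let ?B = "Affine (2 * \<beta> ^ 2) (3 * \<beta> ^ 3)"
  have "x \<in> {- (\<beta> ^ 2)}" if "Affine x 0 \<in> ec_points 0 a" for x
    using two_torsion_sixth_power[OF a that refl] w by blast
  note card = torsion_sixth_power_subset[OF K a \<beta> this]
  show ?thesis
  proof (rule T.iso_integer_mod_group)
    show "?B \<in> carrier (torsion_subgroup E)"
      using order_6_point[OF a] by (auto intro!: exI[of _ "6 :: nat"])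
    show "?B [^]\<^bsub>torsion_subgroup E\<^esub> (6 :: nat) = \<one>\<^bsub>torsion_subgroup E\<^esub>"
      using order_6_point(2)[OF a] by simp
    show "i = 0" if "i < 6" "?B [^]\<^bsub>torsion_subgroup E\<^esub> i = \<one>\<^bsub>torsion_subgroup E\<^esub>" for i :: nat
      using order_6_point(3)[OF a, of i] that by simp
  qed (use card in simp_all)
qed

lemma torsion_iso_2_6:
  assumes K: "quadratic_field TYPE('k)" and a: "a = \<beta> ^ 6" and \<beta>: "\<beta> \<in> \<rat>"
    and w: "(w :: 'k) ^ 2 = - 3"
  shows "torsion_subgroup E \<cong> integer_mod_group 2 \<times>\<times> integer_mod_group 6"
proof -
  interpret T: comm_group "torsion_subgroup E" by (rule torsion_group)
  have "\<beta> \<noteq> 0" using a_nonzero a by auto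
  have "w \<noteq> 0" using w by auto
  \<comment> \<open>The roots of \<open>x ^ 3 = - a\<close> other than
    \<open>- (\<beta> ^ 2)\<close>.\<close>
  define u v where "u = \<beta> ^ 2 * (1 + w) / 2" and "v = \<beta> ^ 2 * (1 - w) / 2"
  have uv: "2 * u = \<beta> ^ 2 * (1 + w)" "2 * v = \<beta> ^ 2 * (1 - w)" unfolding u_def v_def by simp_all
  have "8 * (u ^ 3 + a) = 0" "8 * (v ^ 3 + a) = 0" using uv w a by algebra+
  then have "u ^ 3 + a = 0" "v ^ 3 + a = 0" by (metis mult_eq_0_iff zero_neq_numeral)+
  then have mem: "Affine u 0 \<in> ec_points 0 a" "Affine v 0 \<in> ec_points 0 a" by simp_all
  have "u \<noteq> v"
  proof
    assume "u = v"
    then have "2 * (\<beta> ^ 2 * w) = 0" using uv by (simp add: algebra_simps)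
    then have "\<beta> ^ 2 * w = 0" by simp
    with \<open>\<beta> \<noteq> 0\<close> \<open>w \<noteq> 0\<close> show False by simp
  qed
  let ?B = "Affine (2 * \<beta> ^ 2) (3 * \<beta> ^ 3)"
  note B = order_6_point[OF a]
  \<comment> \<open>\<open>3 B\<close> is a single point, so \<open>u\<close> or \<open>v\<close>
    yields a different one; this makes it unnecessary to compute \<open>3 B\<close>.\<close>
  obtain e where e: "Affine e 0 \<in> ec_points 0 a" "Affine e 0 \<noteq> ?B [^]\<^bsub>E\<^esub> (3 :: nat)"
    using mem \<open>u \<noteq> v\<close> by (metis point.inject)
  let ?A = "Affine e 0"
  have A2: "?A [^]\<^bsub>E\<^esub> (2 :: nat) = Infinity" using pow2_eq_Infinity_iff[OF e(1)] by simp
  have X: "x \<in> {- (\<beta> ^ 2), u, v}" if x: "Affine x 0 \<in> ec_points 0 a" for x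
  proof (cases "x = - (\<beta> ^ 2)")
    case False
    then have "((2 * x - \<beta> ^ 2) / \<beta> ^ 2) ^ 2 = w ^ 2"
      using two_torsion_sixth_power[OF a x refl] w by simp
    then have "(2 * x - \<beta> ^ 2) / \<beta> ^ 2 = w \<or> (2 * x - \<beta> ^ 2) / \<beta> ^ 2 = - w"
      by (simp only: power2_eq_iff)
    then have "2 * x = 2 * u \<or> 2 * x = 2 * v"
      unfolding uv using \<open>\<beta> \<noteq> 0\<close> by (auto simp: field_simps)
    then show ?thesis by auto
  qed simp
  note card = torsion_sixth_power_subset[OF K a \<beta> X]
  have "card {- (\<beta> ^ 2), u, v} \<le> 3" by (simp add: card_insert_if)
  show ?thesis
  proof (rule T.iso_integer_mod_group_Times)
    show "?A \<in> carrier (torsion_subgroup E)"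
      using e(1) A2 by (auto intro!: exI[of _ "2 :: nat"])
    show "?A [^]\<^bsub>torsion_subgroup E\<^esub> (2 :: nat) = \<one>\<^bsub>torsion_subgroup E\<^esub>"
      using A2 by simp
    show "?B \<in> carrier (torsion_subgroup E)"
      using B by (auto intro!: exI[of _ "6 :: nat"])
    show "?B [^]\<^bsub>torsion_subgroup E\<^esub> (6 :: nat) = \<one>\<^bsub>torsion_subgroup E\<^esub>"
      using B(2) by simp
    fix i j :: nat assume ij: "i < 2" "j < 6" "?A [^]\<^bsub>torsion_subgroup E\<^esub> i
        \<otimes>\<^bsub>torsion_subgroup E\<^esub> ?B [^]\<^bsub>torsion_subgroup E\<^esub> j = \<one>\<^bsub>torsion_subgroup E\<^esub>"
    then have eq: "ec_add 0 (?A [^]\<^bsub>E\<^esub> i) (?B [^]\<^bsub>E\<^esub> j) = Infinity" by simp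
    show "i = 0 \<and> j = 0"
    proof (cases "i = 0")
      case True
      then have "?B [^]\<^bsub>E\<^esub> j = Infinity" using eq by simp
      then show ?thesis using B(3) ij(2) True by blast
    next
      case False
      then have "i = 1" using ij(1) by simp
      then have "ec_add 0 ?A (?B [^]\<^bsub>E\<^esub> j) = Infinity" using eq e(1) by simp
      then have A: "?B [^]\<^bsub>E\<^esub> j = ?A"
        using ec_neg_add_cancel[of ?A "?B [^]\<^bsub>E\<^esub> j"] e(1) pow_closed[OF B(1)] by simp
      then have "?B [^]\<^bsub>E\<^esub> (j * 2) = Infinity" using pow_pow[OF B(1), of j 2] A2 by simp
      then have "?B [^]\<^bsub>E\<^esub> (j * 2 mod 6) = Infinity"
        using E.nat_pow_mod[of ?B 6 "j * 2"] B(1,2) by simp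
      then have "j * 2 mod 6 = 0" using B(3)[of "j * 2 mod 6"] by simp
      \<comment> \<open>\<open>j = 0\<close> would make \<open>?A\<close> equal to
        \<open>Infinity\<close>, and \<open>j = 3\<close> contradicts the choice of
        \<open>e\<close>.\<close>
      then have "j = 0 \<or> j = 3" using ij(2) by presburger
      then show ?thesis using A e(2) by auto
    qed
  qed (use card \<open>card {- (\<beta> ^ 2), u, v} \<le> 3\<close> in simp_all)
qed


section \<open>Squares that are not sixth powers\<close>

lemma torsion_no_two_torsion:
  assumes K: "quadratic_field TYPE('k)" and a: "a \<in> \<rat>" and no2: "\<And>x :: 'k. x ^ 3 \<noteq> - a"
    and P: "P \<in> carrier (torsion_subgroup E)"
  shows "P [^]\<^bsub>E\<^esub> (3 :: nat) = Infinity"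
proof -
  have P': "P \<in> ec_points 0 a" using P by simp
  have two: "Q = Infinity" if Q: "Q \<in> ec_points 0 a" "Q [^]\<^bsub>E\<^esub> (2 :: nat) = Infinity" for Q
  proof (cases Q)
    case (Affine x y)
    then have "y = 0" using pow2_eq_Infinity_iff Q by blast
    then have "x ^ 3 = - a" using Q(1) Affine by (simp add: eq_neg_iff_add_eq_0)
    with no2 show ?thesis by blast
  qed simp
  \<comment> \<open>Without points of order two, both factors 2 of 12 can be cancelled in
    turn.\<close>
  have "P [^]\<^bsub>E\<^esub> (12 :: nat) = Infinity"
    using torsion_quadratic_field_pow12[OF K a] P by auto
  then have "(P [^]\<^bsub>E\<^esub> (6 :: nat)) [^]\<^bsub>E\<^esub> (2 :: nat) = Infinity"
    using pow_pow[OF P', of 6 2] by simp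
  then have "P [^]\<^bsub>E\<^esub> (6 :: nat) = Infinity" by (rule two[OF pow_closed[OF P']])
  then have "(P [^]\<^bsub>E\<^esub> (3 :: nat)) [^]\<^bsub>E\<^esub> (2 :: nat) = Infinity"
    using pow_pow[OF P', of 3 2] by simp
  then show ?thesis by (rule two[OF pow_closed[OF P']])
qed

lemma order_3_point:
  assumes "P \<in> ec_points 0 a" "P \<noteq> Infinity" "P [^]\<^bsub>E\<^esub> (3 :: nat) = Infinity"
    "P [^]\<^bsub>E\<^esub> (i :: nat) = Infinity" "i < 3"
  shows "i = 0"
proof (rule ccontr)
  assume "i \<noteq> 0"
  then consider "i = 1" | "i = 2" using assms(5) by linarith
  then show False
  proof cases
    case 2
    then show False using pow_add[OF assms(1), of 2 1] assms by simp
  qed (use assms in simp)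
qed

lemma torsion_iso_3:
  assumes K: "quadratic_field TYPE('k)" and a: "a = \<gamma> ^ 2" "a \<in> \<rat>" and no2: "\<And>x :: 'k. x ^ 3 \<noteq> - a"
    and no3: "\<And>x y. Affine x y \<in> ec_points 0 a \<Longrightarrow> x ^ 3 \<noteq> - 4 * a"
  shows "torsion_subgroup E \<cong> integer_mod_group 3"
proof -
  interpret T: comm_group "torsion_subgroup E" by (rule torsion_group)
  let ?B = "Affine 0 \<gamma>"
  have B: "?B \<in> ec_points 0 a" using a by simp
  then have B3: "?B [^]\<^bsub>E\<^esub> (3 :: nat) = Infinity" using pow3_eq_Infinity_iff by simp
  have sub: "carrier (torsion_subgroup E) \<subseteq> {Infinity, ?B, Affine 0 (- \<gamma>)}"
  proof
    fix P assume P: "P \<in> carrier (torsion_subgroup E)"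
    then have P3: "P [^]\<^bsub>E\<^esub> (3 :: nat) = Infinity" "P \<in> ec_points 0 a"
      using torsion_no_two_torsion[OF K a(2) no2] by simp_all
    show "P \<in> {Infinity, ?B, Affine 0 (- \<gamma>)}"
    proof (cases P)
      case (Affine x y)
      then have "x * (x ^ 3 + 4 * a) = 0" using pow3_eq_Infinity_iff P3 by blast
      moreover have "x ^ 3 + 4 * a \<noteq> 0"
        using no3 P3(2) Affine by (metis add_eq_0_iff2 mult_minus_left)
      ultimately have "x = 0" by simp
      then have "y ^ 2 = \<gamma> ^ 2" using P3(2) Affine a by simp
      then show ?thesis using Affine \<open>x = 0\<close> by (auto simp: power2_eq_iff)
    qed simp
  qed
  have "finite (carrier (torsion_subgroup E))" using sub by (rule finite_subset) simp
  moreover have "card (carrier (torsion_subgroup E)) \<le> 3"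
    using card_mono[OF _ sub] by (simp add: card_insert_if split: if_splits)
  ultimately show ?thesis
  proof (intro T.iso_integer_mod_group)
    show "?B \<in> carrier (torsion_subgroup E)"
      using B B3 by (auto intro!: exI[of _ "3 :: nat"])
    show "?B [^]\<^bsub>torsion_subgroup E\<^esub> (3 :: nat) = \<one>\<^bsub>torsion_subgroup E\<^esub>"
      using B3 by simp
    show "i = 0" if "i < 3" "?B [^]\<^bsub>torsion_subgroup E\<^esub> i = \<one>\<^bsub>torsion_subgroup E\<^esub>" for i :: nat
      using order_3_point[OF B _ B3, of i] that by simp
  qed simp_all
qed

lemma torsion_iso_3_3:
  assumes K: "quadratic_field TYPE('k)" and a: "a = \<gamma> ^ 2" "a \<in> \<rat>" and no2: "\<And>x :: 'k. x ^ 3 \<noteq> - a"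
    and Q: "Affine u v \<in> ec_points 0 a" "u ^ 3 = - 4 * a" and w: "(w :: 'k) ^ 2 = - 3"
  shows "torsion_subgroup E \<cong> integer_mod_group 3 \<times>\<times> integer_mod_group 3"
proof -
  interpret T: comm_group "torsion_subgroup E" by (rule torsion_group)
  let ?B = "Affine 0 \<gamma>" and ?Q = "Affine u v"
  have "u \<noteq> 0" using Q(2) a_nonzero by auto
  have B: "?B \<in> ec_points 0 a" using a by simp
  then have B3: "?B [^]\<^bsub>E\<^esub> (3 :: nat) = Infinity" using pow3_eq_Infinity_iff by simp
  have Q3: "?Q [^]\<^bsub>E\<^esub> (3 :: nat) = Infinity" using pow3_eq_Infinity_iff Q by simp
  \<comment> \<open>The cube roots of \<open>u ^ 3\<close>: \<open>(w - 1) / 2\<close> and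
    \<open>(- w - 1) / 2\<close> are the primitive cube roots of unity.\<close>
  let ?X = "{u, u * (w - 1) / 2, u * (- w - 1) / 2}"
  let ?S = "{Infinity, ?B, Affine 0 (- \<gamma>)} \<union> (\<lambda>(x, y). Affine x y) ` (?X \<times> {v, - v})"
  have sub: "carrier (torsion_subgroup E) \<subseteq> ?S"
  proof
    fix P assume P: "P \<in> carrier (torsion_subgroup E)"
    then have P3: "P [^]\<^bsub>E\<^esub> (3 :: nat) = Infinity" "P \<in> ec_points 0 a"
      using torsion_no_two_torsion[OF K a(2) no2] by simp_all
    show "P \<in> ?S"
    proof (cases P)
      case (Affine x y)
      then have *: "x * (x ^ 3 + 4 * a) = 0" "y ^ 2 = x ^ 3 + a"
        using pow3_eq_Infinity_iff P3 by auto
      show ?thesis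
      proof (cases "x = 0")
        case True
        then have "y ^ 2 = \<gamma> ^ 2" using * a by simp
        then show ?thesis using Affine True by (auto simp: power2_eq_iff)
      next
        case False
        then have "x ^ 3 + 4 * a = 0" using *(1) by simp
        then have x: "x ^ 3 = u ^ 3" using Q(2) by algebra
        then have "y ^ 2 = v ^ 2" using *(2) Q(1) by simp
        then have y: "y \<in> {v, - v}" by (simp add: power2_eq_iff)
        have "(x - u) * (2 * x - u * (w - 1)) * (2 * x - u * (- w - 1)) = 0"
          using x w by algebra
        then have "x = u \<or> 2 * x = u * (w - 1) \<or> 2 * x = u * (- w - 1)"
          by (simp only: mult_eq_0_iff right_minus_eq disj_assoc)
        then have "x = u \<or> x = u * (w - 1) / 2 \<or> x = u * (- w - 1) / 2"
          by (metis nonzero_mult_div_cancel_left zero_neq_numeral)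
        then have "x \<in> ?X" by blast
        then have "(x, y) \<in> ?X \<times> {v, - v}" using y by (rule SigmaI)
        then show ?thesis
          using Affine by (intro UnI2 image_eqI[of _ _ "(x, y)"]) (simp_all only: case_prod_conv)
      qed
    qed simp
  qed
  have "finite (carrier (torsion_subgroup E))" using sub by (rule finite_subset) simp
  moreover have "card (carrier (torsion_subgroup E)) \<le> 3 * 3"
  proof -
    have "card (carrier (torsion_subgroup E)) \<le> card ?S" using sub by (intro card_mono) simp_all
    also have "\<dots> \<le> card {Infinity, ?B, Affine 0 (- \<gamma>)} + card ((\<lambda>(x, y). Affine x y) ` (?X \<times> {v, - v}))"
      by (rule card_Un_le)
    also have "\<dots> \<le> 3 + card (?X \<times> {v, - v})"
      by (intro add_mono card_image_le) (simp_all add: card_insert_if)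
    also have "\<dots> = 3 + card ?X * card {v, - v}" by (simp only: card_cartesian_product)
    also have "\<dots> \<le> 3 + 3 * 2"
      by (intro add_mono mult_mono) (simp_all add: card_insert_if)
    finally show ?thesis by simp
  qed
  ultimately show ?thesis
  proof (intro T.iso_integer_mod_group_Times)
    show "?B \<in> carrier (torsion_subgroup E)" "?Q \<in> carrier (torsion_subgroup E)"
      using B B3 Q Q3 by (auto intro!: exI[of _ "3 :: nat"])
    show "?B [^]\<^bsub>torsion_subgroup E\<^esub> (3 :: nat) = \<one>\<^bsub>torsion_subgroup E\<^esub>"
      "?Q [^]\<^bsub>torsion_subgroup E\<^esub> (3 :: nat) = \<one>\<^bsub>torsion_subgroup E\<^esub>"
      using B3 Q3 by simp_all
    fix i j :: nat assume ij: "i < 3" "j < 3" "?B [^]\<^bsub>torsion_subgroup E\<^esub> i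
        \<otimes>\<^bsub>torsion_subgroup E\<^esub> ?Q [^]\<^bsub>torsion_subgroup E\<^esub> j = \<one>\<^bsub>torsion_subgroup E\<^esub>"
    then have eq: "ec_add 0 (?B [^]\<^bsub>E\<^esub> i) (?Q [^]\<^bsub>E\<^esub> j) = Infinity" by simp
    have pow: "R [^]\<^bsub>E\<^esub> k \<in> {Infinity, R, ec_neg R}"
      if R: "R \<in> ec_points 0 a" "R [^]\<^bsub>E\<^esub> (3 :: nat) = Infinity" "k < 3" for R and k :: nat
    proof -
      from that(3) consider "k = 0" | "k = 1" | "k = 2" by linarith
      then show ?thesis
      proof cases
        case 3
        have "(1 :: nat) + 2 = 3" by simp
        then have "ec_add 0 (R [^]\<^bsub>E\<^esub> (1 :: nat)) (R [^]\<^bsub>E\<^esub> k) = Infinity"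
          using pow_add[OF R(1), of 1 2] R(2) 3 by (simp only:)
        then have "ec_add 0 R (R [^]\<^bsub>E\<^esub> k) = Infinity"
          using R(1) by simp
        then show ?thesis using ec_neg_add_cancel[OF R(1) pow_closed[OF R(1), of k]] by simp
      qed (use R in simp_all)
    qed
    have "?Q [^]\<^bsub>E\<^esub> j = ec_neg (?B [^]\<^bsub>E\<^esub> i)"
      using ec_neg_add_cancel[of "?B [^]\<^bsub>E\<^esub> i" "?Q [^]\<^bsub>E\<^esub> j"] eq pow_closed B Q(1) by simp
    moreover have "?B [^]\<^bsub>E\<^esub> i \<in> {Infinity, ?B, ec_neg ?B}" by (rule pow[OF B B3 ij(1)])
    moreover have "?Q [^]\<^bsub>E\<^esub> j \<in> {Infinity, ?Q, ec_neg ?Q}" by (rule pow[OF Q(1) Q3 ij(2)])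
    \<comment> \<open>Affine multiples of \<open>?B\<close> have abscissa 0, those of
      \<open>?Q\<close> have abscissa \<open>u\<close>, so only \<open>Infinity\<close> is common to
      both.\<close>
    ultimately have Inf: "?Q [^]\<^bsub>E\<^esub> j = Infinity" using \<open>u \<noteq> 0\<close> by auto
    then have "j = 0" using order_3_point[OF Q(1) _ Q3] ij(2) by blast
    have "?B [^]\<^bsub>E\<^esub> i = Infinity" using eq Inf by simp
    then have "i = 0" using order_3_point[OF B _ B3] ij(1) by blast
    with \<open>j = 0\<close> show "i = 0 \<and> j = 0" by simp
  qed simp_all
qed

end

text \<open>Such an \<open>x\<close> would be the abscissa of a point of order two. Then
  \<open>- (c ^ 2)\<close> is a rational cube, hence an integer cube, and an integer that is both a
  square and a cube is a sixth power.\<close>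

lemma cube_neq_minus_square:
  fixes x :: "'k :: field_char_0" and c :: int
  assumes K: "quadratic_field TYPE('k)" and c: "\<nexists>b :: int. c ^ 2 = b ^ 6"
  shows "x ^ 3 \<noteq> - of_int (c ^ 2)"
proof
  assume "x ^ 3 = - of_int (c ^ 2)"
  then have "x ^ 3 = of_rat (of_int (- (c ^ 2)))"
    by (simp add: of_rat_minus of_rat_power)
  then obtain q :: rat where q: "q ^ 3 = of_int (- (c ^ 2))"
    by (rule quadratic_field_rational_cube[OF K])
  then obtain k where k: "q = of_int k" by (rule rat_power_eq_of_intE) simp
  with q have "of_int (k ^ 3) = (of_int (- (c ^ 2)) :: rat)" by simp
  then have "k ^ 3 = - (c ^ 2)" by (simp only: of_int_eq_iff)
  then have "c ^ 2 = (- k) ^ 3" by simp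
  then obtain b where "c = b ^ 3" by (rule square_eq_cube_imp_cube)
  then have "c ^ 2 = b ^ 6" by (simp flip: power_mult)
  with c show False by blast
qed

theorem theorem2:
  fixes a :: int
  assumes "a \<noteq> 0"
    and "quadratic_field TYPE('k :: field_char_0)"
  shows
    "((\<exists>b :: int. a = b ^ 6) \<longrightarrow>
        (\<not> is_Q_sqrt_minus_3 TYPE('k) \<longrightarrow>
           torsion_subgroup (ec_group (0 :: 'k) (of_int a)) \<cong> integer_mod_group 6 \<or>
           torsion_subgroup (ec_group (0 :: 'k) (of_int a)) \<cong> integer_mod_group 12 \<or>
           torsion_subgroup (ec_group (0 :: 'k) (of_int a)) \<cong> integer_mod_group 18) \<and>
        (is_Q_sqrt_minus_3 TYPE('k) \<longrightarrow>
           torsion_subgroup (ec_group (0 :: 'k) (of_int a))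
             \<cong> integer_mod_group 2 \<times>\<times> integer_mod_group 6)) \<and>
     ((\<exists>b :: int. a = b ^ 2) \<and> \<not> (\<exists>b :: int. a = b ^ 6) \<longrightarrow>
        (\<not> is_Q_sqrt_minus_3 TYPE('k) \<longrightarrow>
           torsion_subgroup (ec_group (0 :: 'k) (of_int a)) \<cong> integer_mod_group 3 \<or>
           torsion_subgroup (ec_group (0 :: 'k) (of_int a)) \<cong> integer_mod_group 9) \<and>
        (is_Q_sqrt_minus_3 TYPE('k) \<longrightarrow>
           torsion_subgroup (ec_group (0 :: 'k) (of_int a)) \<cong> integer_mod_group 3 \<or>
           torsion_subgroup (ec_group (0 :: 'k) (of_int a)) \<cong> integer_mod_group 9 \<or>
           torsion_subgroup (ec_group (0 :: 'k) (of_int a))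
             \<cong> integer_mod_group 3 \<times>\<times> integer_mod_group 3))"
proof -
  note K = assms(2)
  interpret mordell_curve "of_int a :: 'k"
    by unfold_locales (use assms(1) in simp)
  note w = is_Q_sqrt_minus_3_iff[OF K]
  have rat: "(of_int n :: 'k) \<in> \<rat>" for n by simp
  have sixth: "(\<not> is_Q_sqrt_minus_3 TYPE('k) \<longrightarrow> torsion_subgroup E \<cong> integer_mod_group 6) \<and>
      (is_Q_sqrt_minus_3 TYPE('k) \<longrightarrow>
        torsion_subgroup E \<cong> integer_mod_group 2 \<times>\<times> integer_mod_group 6)"
    if "a = b ^ 6" for b
  proof -
    have "(of_int a :: 'k) = of_int b ^ 6" using that by simp
    then show ?thesis using torsion_iso_6[OF K _ rat] torsion_iso_2_6[OF K _ rat] w by blast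
  qed
  have square: "torsion_subgroup E \<cong> integer_mod_group 3 \<or>
      is_Q_sqrt_minus_3 TYPE('k) \<and>
        torsion_subgroup E \<cong> integer_mod_group 3 \<times>\<times> integer_mod_group 3"
    if c: "a = c ^ 2" and no6: "\<nexists>b. a = b ^ 6" for c
  proof -
    have a: "(of_int a :: 'k) = of_int c ^ 2" using c by simp
    have no2: "x ^ 3 \<noteq> - (of_int a :: 'k)" for x
      using cube_neq_minus_square[OF K, of c x] no6 c by simp
    show ?thesis
    proof (cases "\<exists>u v :: 'k. Affine u v \<in> ec_points 0 (of_int a) \<and> u ^ 3 = - 4 * of_int a")
      case False
      then show ?thesis using torsion_iso_3[OF K a rat no2] by blast
    next
      case True
      then obtain u v :: 'k where uv: "Affine u v \<in> ec_points 0 (of_int a)" "u ^ 3 = - 4 * of_int a"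
        by blast
      \<comment> \<open>\<open>u ^ 3 = - 4 * a\<close> gives \<open>v ^ 2 = - 3 * a\<close> with
        \<open>a\<close> a square: the existence of this point alone puts a square root of -3 into
        the field.\<close>
      have "v ^ 2 = - 3 * of_int c ^ 2" using uv a by simp
      then have "(v / of_int c) ^ 2 = - 3"
        using c assms(1) by (simp add: power_divide)
      then show ?thesis using torsion_iso_3_3[OF K a rat no2 uv] w by blast
    qed
  qed
  show ?thesis using sixth square by blast
qed

end
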